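(* Let $K$ be a field containing an element of multiplicative order $3$, with $|K|\neq 4$, and let \[\mathrm{H}_{27}=\langle a,b,c \mid a^3=b^3=c^3=1,\ a^{-1}b^{-1}ab=c,\ ac=ca,\ bc=cb \rangle\] be the Heisenberg group of order $27$. Then $\beta_{\mathrm{sep}}^K(\mathrm{H}_{27})=9$.
   Context: Let $K$ be a field and $G$ a finite group with $\mathrm{char}(K)\nmid |G|$. For a finite dimensional $KG$-module $V$, $K[V]$ is the polynomial ring in the coordinate functions on $V$, on which $G$ acts by $(g\cdot f)(v)=f(g^{-1}v)$, and $K[V]^G$ is the subalgebra of $G$-invariants. A subset $S\subseteq K[V]^G$ is a separating set if whenever $v,w\in V$ have different $G$-orbits, there is $f\in S$ with $f(v)\ne f(w)$. The number $\beta_{\mathrm{sep}}(G,V)$ is the minimal positive integer $d$ such that the elements of $K[V]^G$ of degree at most $d$ form a separating set, and $\beta_{\mathrm{sep}}^K(G)$ is the supremum of $\beta_{\mathrm{sep}}(G,V)$ over all finite dimensional $KG$-modules $V$. *)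

theory Defs
  imports
    "HOL-Library.Poly_Mapping"
    "HOL-Library.Extended_Nat"
    "HOL-Algebra.Group"
    "Jordan_Normal_Form.Matrix"
begin

section \<open>Groups given by generators and relations\<close>

text \<open>A word is a list of letters; \<open>(x, True)\<close> is the generator \<open>x\<close> and \<open>(x, False)\<close> its
  formal inverse. A relation \<open>u = v\<close> is the pair \<open>(u, v)\<close>. The presented group consists of the
  classes of the least congruence on words that contains the given relations and cancellation
  of mutually inverse letters.\<close>

type_synonym 'x word = "('x \<times> bool) list"

inductive pres_cong :: "('x word \<times> 'x word) set \<Rightarrow> 'x word \<Rightarrow> 'x word \<Rightarrow> bool"
  for R where
  pc_refl: "pres_cong R u u"
| pc_sym: "pres_cong R u v \<Longrightarrow> pres_cong R v u"
| pc_trans: "pres_cong R u v \<Longrightarrow> pres_cong R v w \<Longrightarrow> pres_cong R u w"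
| pc_append: "pres_cong R u u' \<Longrightarrow> pres_cong R v v' \<Longrightarrow> pres_cong R (u @ v) (u' @ v')"
| pc_cancel: "pres_cong R [(x, e), (x, \<not> e)] []"
| pc_rel: "(u, v) \<in> R \<Longrightarrow> pres_cong R u v"

definition pres_class :: "('x word \<times> 'x word) set \<Rightarrow> 'x word \<Rightarrow> 'x word set" where
  "pres_class R u = {v. pres_cong R u v}"

definition presented_group :: "('x word \<times> 'x word) set \<Rightarrow> 'x word set monoid" where
  "presented_group R =
     \<lparr>carrier = range (pres_class R),
      mult = (\<lambda>X Y. {w. \<exists>u\<in>X. \<exists>v\<in>Y. pres_cong R (u @ v) w}),
      one = pres_class R []\<rparr>"

lemma pres_class_eq_iff: "pres_class R u = pres_class R v \<longleftrightarrow> pres_cong R u v"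
  unfolding pres_class_def by (auto intro: pc_refl pc_sym pc_trans)

lemma presented_group_mult:
  "pres_class R u \<otimes>\<^bsub>presented_group R\<^esub> pres_class R v = pres_class R (u @ v)"
  unfolding pres_class_def presented_group_def
  by (auto intro: pc_refl pc_trans pc_append)

lemma pres_cong_inverse: "pres_cong R (map (\<lambda>(x, e). (x, \<not> e)) (rev u) @ u) []"
proof (induction u)
  case Nil
  show ?case by (simp add: pc_refl)
next
  case (Cons l u)
  obtain x e where l: "l = (x, e)" by (cases l)
  let ?i = "map (\<lambda>(x, e). (x, \<not> e)) (rev u)"
  have c: "pres_cong R [(x, \<not> e), (x, e)] []"
    using pc_cancel[of R x "\<not> e"] by simp
  have "pres_cong R (?i @ ([(x, \<not> e), (x, e)] @ u)) (?i @ ([] @ u))"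
    by (intro pc_append pc_refl c)
  with Cons.IH show ?case by (auto simp: l intro: pc_trans)
qed

lemma group_presented_group: "group (presented_group R)"
proof (rule groupI)
  fix X assume "X \<in> carrier (presented_group R)"
  then obtain u where X: "X = pres_class R u" by (auto simp: presented_group_def)
  let ?Y = "pres_class R (map (\<lambda>(x, e). (x, \<not> e)) (rev u))"
  have "?Y \<otimes>\<^bsub>presented_group R\<^esub> X = pres_class R []"
    unfolding X presented_group_mult pres_class_eq_iff by (rule pres_cong_inverse)
  then show "\<exists>Y\<in>carrier (presented_group R). Y \<otimes>\<^bsub>presented_group R\<^esub> X = \<one>\<^bsub>presented_group R\<^esub>"
    by (intro bexI[of _ ?Y]) (auto simp: presented_group_def)
next
  fix X assume "X \<in> carrier (presented_group R)"
  then obtain u where X: "X = pres_class R u" by (auto simp: presented_group_def)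
  have one: "\<one>\<^bsub>presented_group R\<^esub> = pres_class R []" by (simp add: presented_group_def)
  show "\<one>\<^bsub>presented_group R\<^esub> \<otimes>\<^bsub>presented_group R\<^esub> X = X"
    unfolding one X presented_group_mult by simp
next
  fix X Y assume "X \<in> carrier (presented_group R)" "Y \<in> carrier (presented_group R)"
  then obtain u v where XY: "X = pres_class R u" "Y = pres_class R v"
    by (auto simp: presented_group_def)
  show "X \<otimes>\<^bsub>presented_group R\<^esub> Y \<in> carrier (presented_group R)"
    unfolding XY presented_group_mult by (simp add: presented_group_def)
next
  fix X Y Z
  assume "X \<in> carrier (presented_group R)" "Y \<in> carrier (presented_group R)"
    "Z \<in> carrier (presented_group R)"
  then obtain u v w where "X = pres_class R u" "Y = pres_class R v" "Z = pres_class R w"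
    by (auto simp: presented_group_def)
  then show "X \<otimes>\<^bsub>presented_group R\<^esub> Y \<otimes>\<^bsub>presented_group R\<^esub> Z =
      X \<otimes>\<^bsub>presented_group R\<^esub> (Y \<otimes>\<^bsub>presented_group R\<^esub> Z)"
    by (simp add: presented_group_mult)
qed (simp add: presented_group_def)

datatype heis_gen = GA | GB | GC

definition heis_rels :: "(heis_gen word \<times> heis_gen word) set" where
  "heis_rels =
    (let a = (GA, True); b = (GB, True); c = (GC, True); a' = (GA, False); b' = (GB, False)
     in {([a, a, a], []), ([b, b, b], []), ([c, c, c], []),
         ([a', b', a, b], [c]), ([a, c], [c, a]), ([b, c], [c, b])})"

definition H27 :: "heis_gen word set monoid" where
  "H27 = presented_group heis_rels"

section \<open>Polynomials\<close>

text \<open>Polynomials are formal, not functions: the distinction matters over finite fields.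
  A monomial is its exponent vector; \<open>K[V]\<close> for \<open>V = K\<^sup>n\<close> is the set of polynomials in the
  variables with index \<open>< n\<close>.\<close>

type_synonym 'k mpoly = "(nat \<Rightarrow>\<^sub>0 nat) \<Rightarrow>\<^sub>0 'k"

definition mp_const :: "'k::zero \<Rightarrow> 'k mpoly" where
  "mp_const c = Poly_Mapping.single 0 c"

definition mp_var :: "nat \<Rightarrow> 'k::zero_neq_one mpoly" where
  "mp_var i = Poly_Mapping.single (Poly_Mapping.single i 1) 1"

definition mp_ring :: "nat \<Rightarrow> 'k::zero mpoly set" where
  "mp_ring n = {f. \<forall>m\<in>Poly_Mapping.keys f. Poly_Mapping.keys m \<subseteq> {..<n}}"

definition mp_total_degree :: "'k::zero mpoly \<Rightarrow> nat" where
  "mp_total_degree f =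
     Max (insert 0 ((\<lambda>m. \<Sum>i\<in>Poly_Mapping.keys m. Poly_Mapping.lookup m i) ` Poly_Mapping.keys f))"

text \<open>Replace the \<open>i\<close>-th variable by \<open>s i\<close> and map the coefficients along \<open>h\<close>; evaluation and
  substitution of polynomials are both instances.\<close>

definition mp_insertion ::
    "('k::zero \<Rightarrow> 'r::comm_semiring_1) \<Rightarrow> (nat \<Rightarrow> 'r) \<Rightarrow> 'k mpoly \<Rightarrow> 'r" where
  "mp_insertion h s f =
     (\<Sum>m\<in>Poly_Mapping.keys f.
        h (Poly_Mapping.lookup f m) * (\<Prod>i\<in>Poly_Mapping.keys m. s i ^ Poly_Mapping.lookup m i))"

definition mp_eval :: "'k::comm_semiring_1 mpoly \<Rightarrow> 'k vec \<Rightarrow> 'k" where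
  "mp_eval f v = mp_insertion (\<lambda>c. c) (\<lambda>i. v $ i) f"

definition mp_subst :: "(nat \<Rightarrow> 'k::comm_semiring_1 mpoly) \<Rightarrow> 'k mpoly \<Rightarrow> 'k mpoly" where
  "mp_subst s f = mp_insertion mp_const s f"

section \<open>Modules, invariants and separating sets\<close>

text \<open>A \<open>KG\<close>-module of dimension \<open>n\<close>, after choice of a basis: the space \<open>K\<^sup>n\<close> (that is,
  \<open>carrier_vec n\<close>) on which \<open>g\<close> acts as the matrix \<open>\<rho> g\<close>.\<close>

definition is_rep :: "('g, 'b) monoid_scheme \<Rightarrow> nat \<Rightarrow> ('g \<Rightarrow> 'k::field mat) \<Rightarrow> bool" where
  "is_rep G n \<rho> \<longleftrightarrow>
     (\<forall>g\<in>carrier G. \<rho> g \<in> carrier_mat n n) \<and>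
     \<rho> \<one>\<^bsub>G\<^esub> = 1\<^sub>m n \<and>
     (\<forall>g\<in>carrier G. \<forall>h\<in>carrier G. \<rho> (g \<otimes>\<^bsub>G\<^esub> h) = \<rho> g * \<rho> h)"

definition rep_orbit :: "('g, 'b) monoid_scheme \<Rightarrow> ('g \<Rightarrow> 'k::field mat) \<Rightarrow> 'k vec \<Rightarrow> 'k vec set" where
  "rep_orbit G \<rho> v = {\<rho> g *\<^sub>v v | g. g \<in> carrier G}"

text \<open>\<open>(g \<cdot> f)(v) = f (g\<^sup>-\<^sup>1 v)\<close> on formal polynomials: the \<open>i\<close>-th coordinate function is replaced
  by the \<open>i\<close>-th coordinate of \<open>g\<^sup>-\<^sup>1 v\<close>, a linear form in the coordinates of \<open>v\<close>.\<close>

definition poly_act ::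
    "('g, 'b) monoid_scheme \<Rightarrow> nat \<Rightarrow> ('g \<Rightarrow> 'k::field mat) \<Rightarrow> 'g \<Rightarrow> 'k mpoly \<Rightarrow> 'k mpoly" where
  "poly_act G n \<rho> g f =
     mp_subst (\<lambda>i. \<Sum>j<n. mp_const (\<rho> (inv\<^bsub>G\<^esub> g) $$ (i, j)) * mp_var j) f"

definition invariants ::
    "('g, 'b) monoid_scheme \<Rightarrow> nat \<Rightarrow> ('g \<Rightarrow> 'k::field mat) \<Rightarrow> 'k mpoly set" where
  "invariants G n \<rho> = {f \<in> mp_ring n. \<forall>g\<in>carrier G. poly_act G n \<rho> g f = f}"

definition separating_set ::
    "('g, 'b) monoid_scheme \<Rightarrow> nat \<Rightarrow> ('g \<Rightarrow> 'k::field mat) \<Rightarrow> 'k mpoly set \<Rightarrow> bool" where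
  "separating_set G n \<rho> S \<longleftrightarrow>
     S \<subseteq> invariants G n \<rho> \<and>
     (\<forall>v\<in>carrier_vec n. \<forall>w\<in>carrier_vec n.
        rep_orbit G \<rho> v \<noteq> rep_orbit G \<rho> w \<longrightarrow> (\<exists>f\<in>S. mp_eval f v \<noteq> mp_eval f w))"

definition beta_sep_module ::
    "('g, 'b) monoid_scheme \<Rightarrow> nat \<Rightarrow> ('g \<Rightarrow> 'k::field mat) \<Rightarrow> nat" where
  "beta_sep_module G n \<rho> =
     (LEAST d. 0 < d \<and> separating_set G n \<rho> {f \<in> invariants G n \<rho>. mp_total_degree f \<le> d})"

text \<open>The supremum is taken in \<open>enat\<close>, so that it is meaningful without a boundedness proof.\<close>

definition beta_sep :: "'k::field itself \<Rightarrow> ('g, 'b) monoid_scheme \<Rightarrow> enat" where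
  "beta_sep (K :: 'k itself) G =
     (SUP (n, \<rho> :: 'g \<Rightarrow> 'k mat) \<in> {(n, \<rho>). is_rep G n \<rho>}. enat (beta_sep_module G n \<rho>))"

end

(*
Lower bound: on the three-dimensional representation in which a permutes the coordinates cyclically,
b = diag(1, \<omega>, \<omega>^2) and c = \<omega>, the invariants of degree at most 8 take equal values at (0, 1, t) and
(1, 0, t), while the cyclic sum of x^6 y^3 distinguishes these points if t is nonzero and t^3 is not
1; such t exists because |K| is not 4.

Upper bound: suppose that all invariants of degree at most 9 agree at v and w. Products of at most
four weight vectors separate the orbits of the abelian group generated by c and a noncentral element.
If some semi-invariant f of degree at most 2 whose character of H/<c> is nontrivial has f(v) nonzero,
let N be the kernel of that character, which is such an abelian group: an N-invariant of degree at
most 4 splits into semi-invariants, and each becomes H-invariant after multiplication by f or f^2, in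
degree at most 8. So all these N-invariants agree after v is moved by a power of an element outside
N. If all such f vanish at v, then looking at products of linear forms of c-weights 1 and 2 one sees
that all linear forms of c-weight 1, or all those of c-weight 2, vanish at v. On the remaining weight
only cubic <b, c>-invariants are needed, and products of three of their a-weight components have
degree 9.
*)
theory Submission
  imports Defs
begin

section \<open>Synchronising cube roots of unity\<close>

text \<open>The obstacle is the passage from an abelian subgroup of index three to the whole group.
  Splitting invariants of degree four into a-weight components and multiplying three of these would
  reach degree twelve. A semi-invariant nonzero at v repairs each component separately with an
  exponent of at most two, so degree two is the most it may have: 4 + 2 * 2 = 8. Without one, a
  single nontrivial c-weight remains, and a c-invariant product of vectors of that weight has a
  number of factors divisible by three; fourfold products drop out and 3 * 3 = 9 is the extreme
  case. The number four comes from the plane over F_3: linearity on weights has to be tested on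
  three vectors only, and negating the coefficients mod 3 if necessary makes their sum at most four.
  Over a finite field a polynomial with invariant values need not be formally invariant. The upper
  bound is therefore argued for functions on a bare set, and formal invariants arise at the end by
  averaging. The bare set also allows other generators with the same relations, so that each of the
  four kernels can take the role of the subgroup generated by b and c.\<close>

lemma cong3_linear_on_triples:
  fixes T :: "(int \<times> int \<times> int) set"
  assumes zero: "(0, 0, 0) \<in> T"
    and quad: "\<And>i1 j1 k1 i2 j2 k2 i3 j3 k3 i4 j4 k4.
      (i1, j1, k1) \<in> T \<Longrightarrow> (i2, j2, k2) \<in> T \<Longrightarrow> (i3, j3, k3) \<in> T \<Longrightarrow> (i4, j4, k4) \<in> T \<Longrightarrow>
      3 dvd i1 + i2 + i3 + i4 \<Longrightarrow> 3 dvd j1 + j2 + j3 + j4 \<Longrightarrow> 3 dvd k1 + k2 + k3 + k4"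
    and T: "(i1, j1, k1) \<in> T" "(i2, j2, k2) \<in> T" "(i3, j3, k3) \<in> T"
    and i: "3 dvd \<alpha> * i1 + \<beta> * i2 + \<gamma> * i3" and j: "3 dvd \<alpha> * j1 + \<beta> * j2 + \<gamma> * j3"
  shows "3 dvd \<alpha> * k1 + \<beta> * k2 + \<gamma> * (k3::int)"
proof -
  have red: "3 dvd x * u + y * v + z * w \<longleftrightarrow>
      3 dvd (x mod 3) * u + (y mod 3) * v + (z mod 3) * (w::int)" for x y z u v w :: int
  proof -
    have "x * u + y * v + z * w =
        (x mod 3 + 3 * (x div 3)) * u + (y mod 3 + 3 * (y div 3)) * v + (z mod 3 + 3 * (z div 3)) * w"
      by (simp only: mod_mult_div_eq)
    also have "\<dots> = (x mod 3) * u + (y mod 3) * v + (z mod 3) * w +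
        3 * ((x div 3) * u + (y div 3) * v + (z div 3) * w)"
      by (simp only: distrib_left distrib_right mult.assoc add.assoc add.commute add.left_commute)
    finally show ?thesis by (simp only: dvd_add_times_triv_right_iff mult.commute[of 3])
  qed
  have c: "x mod 3 = 0 \<or> x mod 3 = 1 \<or> x mod 3 = 2" for x :: int
    by presburger
  have i': "3 dvd (\<alpha> mod 3) * i1 + (\<beta> mod 3) * i2 + (\<gamma> mod 3) * i3"
    and j': "3 dvd (\<alpha> mod 3) * j1 + (\<beta> mod 3) * j2 + (\<gamma> mod 3) * j3"
    using i j red by blast+
  \<comment> \<open>If the reduced coefficients add up to more than four, doubling them modulo three brings
    their sum down to at most four.\<close>
  define R where "R x y z \<longleftrightarrow> (3 dvd x * i1 + y * i2 + z * i3 \<longrightarrow> 3 dvd x * j1 + y * j2 + z * j3 \<longrightarrow>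
      3 dvd x * k1 + y * k2 + z * k3)" for x y z
  have r0: "R 0 0 0" using quad[OF zero zero zero zero] by (simp add: R_def algebra_simps)
  have r1: "R 0 0 1" using quad[OF zero zero zero T(3)] by (simp add: R_def algebra_simps)
  have r2: "R 0 0 2" using quad[OF zero zero T(3) T(3)] by (simp add: R_def algebra_simps)
  have r3: "R 0 1 0" using quad[OF zero zero zero T(2)] by (simp add: R_def algebra_simps)
  have r4: "R 0 1 1" using quad[OF zero zero T(2) T(3)] by (simp add: R_def algebra_simps)
  have r5: "R 0 1 2" using quad[OF zero T(2) T(3) T(3)] by (simp add: R_def algebra_simps)
  have r6: "R 0 2 0" using quad[OF zero zero T(2) T(2)] by (simp add: R_def algebra_simps)
  have r7: "R 0 2 1" using quad[OF zero T(2) T(2) T(3)] by (simp add: R_def algebra_simps)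
  have r8: "R 0 2 2" using quad[OF T(2) T(2) T(3) T(3)] by (simp add: R_def algebra_simps)
  have r9: "R 1 0 0" using quad[OF zero zero zero T(1)] by (simp add: R_def algebra_simps)
  have r10: "R 1 0 1" using quad[OF zero zero T(1) T(3)] by (simp add: R_def algebra_simps)
  have r11: "R 1 0 2" using quad[OF zero T(1) T(3) T(3)] by (simp add: R_def algebra_simps)
  have r12: "R 1 1 0" using quad[OF zero zero T(1) T(2)] by (simp add: R_def algebra_simps)
  have r13: "R 1 1 1" using quad[OF zero T(1) T(2) T(3)] by (simp add: R_def algebra_simps)
  have r14: "R 1 1 2" using quad[OF T(1) T(2) T(3) T(3)] by (simp add: R_def algebra_simps)
  have r15: "R 1 2 0" using quad[OF zero T(1) T(2) T(2)] by (simp add: R_def algebra_simps)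
  have r16: "R 1 2 1" using quad[OF T(1) T(2) T(2) T(3)] by (simp add: R_def algebra_simps)
  have r17: "R 1 2 2" using quad[OF T(1) T(1) T(2) T(3)] unfolding R_def by presburger
  have r18: "R 2 0 0" using quad[OF zero zero T(1) T(1)] by (simp add: R_def algebra_simps)
  have r19: "R 2 0 1" using quad[OF zero T(1) T(1) T(3)] by (simp add: R_def algebra_simps)
  have r20: "R 2 0 2" using quad[OF T(1) T(1) T(3) T(3)] by (simp add: R_def algebra_simps)
  have r21: "R 2 1 0" using quad[OF zero T(1) T(1) T(2)] by (simp add: R_def algebra_simps)
  have r22: "R 2 1 1" using quad[OF T(1) T(1) T(2) T(3)] by (simp add: R_def algebra_simps)
  have r23: "R 2 1 2" using quad[OF T(1) T(2) T(2) T(3)] unfolding R_def by presburger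
  have r24: "R 2 2 0" using quad[OF T(1) T(1) T(2) T(2)] by (simp add: R_def algebra_simps)
  have r25: "R 2 2 1" using quad[OF T(1) T(2) T(3) T(3)] unfolding R_def by presburger
  have r26: "R 2 2 2" using quad[OF zero T(1) T(2) T(3)] unfolding R_def by presburger
  have "R (\<alpha> mod 3) (\<beta> mod 3) (\<gamma> mod 3)"
    using c[of \<alpha>] c[of \<beta>] c[of \<gamma>]
    by (elim disjE; simp only: r0 r1 r2 r3 r4 r5 r6 r7 r8 r9 r10 r11 r12 r13 r14 r15 r16 r17 r18 r19 r20 r21 r22 r23 r24 r25 r26)
  then have "3 dvd (\<alpha> mod 3) * k1 + (\<beta> mod 3) * k2 + (\<gamma> mod 3) * k3"
    using i' j' unfolding R_def by blast
  then show ?thesis using red by blast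
qed

text \<open>The pairs (i, j) span a space of dimension at most two over F_3, so relations among
  three elements decide everything. The proof splits on the rank of these pairs. Cramer's rule gives
  x and y, without division because a nonzero residue mod 3 is its own inverse
  (\<open>sq\<close>).\<close>

lemma cong3_linear:
  fixes T :: "(int \<times> int \<times> int) set"
  assumes zero: "(0, 0, 0) \<in> T"
    and quad: "\<And>i1 j1 k1 i2 j2 k2 i3 j3 k3 i4 j4 k4.
      (i1, j1, k1) \<in> T \<Longrightarrow> (i2, j2, k2) \<in> T \<Longrightarrow> (i3, j3, k3) \<in> T \<Longrightarrow> (i4, j4, k4) \<in> T \<Longrightarrow>
      3 dvd i1 + i2 + i3 + i4 \<Longrightarrow> 3 dvd j1 + j2 + j3 + j4 \<Longrightarrow> 3 dvd k1 + k2 + k3 + k4"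
  shows "\<exists>x y. \<forall>(i, j, k)\<in>T. 3 dvd k - (x * i + y * j)"
proof -
  have lin: "3 dvd \<alpha> * k1 + \<beta> * k2 + \<gamma> * k3"
    if "(i1, j1, k1) \<in> T" "(i2, j2, k2) \<in> T" "(i3, j3, k3) \<in> T"
      "3 dvd \<alpha> * i1 + \<beta> * i2 + \<gamma> * i3" "3 dvd \<alpha> * j1 + \<beta> * j2 + \<gamma> * j3"
    for \<alpha> \<beta> \<gamma> i1 j1 k1 i2 j2 k2 i3 j3 k3
    using zero quad that by (rule cong3_linear_on_triples)
  have sq: "3 dvd D * D - 1" if "\<not> 3 dvd D" for D :: int
  proof -
    have "D mod 3 = 1 \<or> D mod 3 = 2" using that by presburger
    then obtain q where "D = 3 * q + 1 \<or> D = 3 * q + 2"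
      by (metis div_mult_mod_eq mult.commute)
    then have "D * D - 1 = 3 * (3 * q * q + 2 * q) \<or> D * D - 1 = 3 * (3 * q * q + 4 * q + 1)"
      by (auto simp: algebra_simps)
    then show ?thesis by fastforce
  qed
  show ?thesis
  proof (cases "\<exists>i1 j1 k1 i2 j2 k2. (i1, j1, k1) \<in> T \<and> (i2, j2, k2) \<in> T \<and> \<not> 3 dvd i1 * j2 - i2 * j1")
    case True
    then obtain i1 j1 k1 i2 j2 k2 where T: "(i1, j1, k1) \<in> T" "(i2, j2, k2) \<in> T"
      and nd: "\<not> 3 dvd i1 * j2 - i2 * j1" by blast
    define D where "D = i1 * j2 - i2 * j1"
    define x where "x = D * (k1 * j2 - k2 * j1)"
    define y where "y = D * (i1 * k2 - i2 * k1)"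
    have "3 dvd k - (x * i + y * j)" if t: "(i, j, k) \<in> T" for i j k
    proof -
      \<comment> \<open>The coefficients are the two by two minors, so the sums for i and j vanish
        identically.\<close>
      have "3 dvd (i * j2 - i2 * j) * k1 + (i1 * j - i * j1) * k2 + (- D) * k"
        by (rule lin[OF T t]) (auto simp: D_def algebra_simps)
      then have 1: "3 dvd (- D) * ((i * j2 - i2 * j) * k1 + (i1 * j - i * j1) * k2 + (- D) * k)"
        by (rule dvd_mult)
      have 2: "3 dvd k * (D * D - 1)"
        using sq[of D] nd by (simp add: D_def)
      have "k - (x * i + y * j) =
        (- D) * ((i * j2 - i2 * j) * k1 + (i1 * j - i * j1) * k2 + (- D) * k) - k * (D * D - 1)"
        by (simp add: x_def y_def algebra_simps)
      then show ?thesis using 1 2 by (metis dvd_diff)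
    qed
    then show ?thesis by blast
  next
    case dep: False
    show ?thesis
    proof (cases "\<exists>i j k. (i, j, k) \<in> T \<and> (\<not> 3 dvd i \<or> \<not> 3 dvd j)")
      case True
      then obtain i1 j1 k1 where T: "(i1, j1, k1) \<in> T" and nd: "\<not> 3 dvd i1 \<or> \<not> 3 dvd j1" by blast
      have d: "3 dvd i1 * j - i * j1" if "(i, j, k) \<in> T" for i j k
        using dep that T by blast
      have ri: "3 dvd i * k1 + (- i1) * k" if t: "(i, j, k) \<in> T" for i j k
      proof -
        have "3 dvd i * k1 + (- i1) * k + 0 * 0"
          using d[OF t] by (intro lin[OF T t zero])
            (auto simp: algebra_simps dvd_diff_commute)
        then show ?thesis by simp
      qed
      have rj: "3 dvd j * k1 + (- j1) * k" if t: "(i, j, k) \<in> T" for i j k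
      proof -
        have "3 dvd j * k1 + (- j1) * k + 0 * 0"
          using d[OF t] by (intro lin[OF T t zero])
            (auto simp: algebra_simps dvd_diff_commute)
        then show ?thesis by simp
      qed
      from nd show ?thesis
      proof
        assume n: "\<not> 3 dvd i1"
        have "3 dvd k - (i1 * k1 * i + 0 * j)" if t: "(i, j, k) \<in> T" for i j k
        proof -
          have "k - (i1 * k1 * i + 0 * j) = (- i1) * (i * k1 + (- i1) * k) - k * (i1 * i1 - 1)"
            by (simp add: algebra_simps)
          then show ?thesis using ri[OF t] sq[OF n] by (metis dvd_diff dvd_mult)
        qed
        then show ?thesis by blast
      next
        assume n: "\<not> 3 dvd j1"
        have "3 dvd k - (0 * i + j1 * k1 * j)" if t: "(i, j, k) \<in> T" for i j k
        proof -
          have "k - (0 * i + j1 * k1 * j) = (- j1) * (j * k1 + (- j1) * k) - k * (j1 * j1 - 1)"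
            by (simp add: algebra_simps)
          then show ?thesis using rj[OF t] sq[OF n] by (metis dvd_diff dvd_mult)
        qed
        then show ?thesis by blast
      qed
    next
      case False
      have "3 dvd k - (0 * i + 0 * j)" if t: "(i, j, k) \<in> T" for i j k
        using quad[OF zero zero zero t] False t by auto
      then show ?thesis by blast
    qed
  qed
qed

section \<open>Arithmetic of a primitive cube root of unity\<close>

locale cube_root =
  fixes \<omega> :: "'k::field"
  assumes omega_cube: "\<omega> ^ 3 = 1" and omega_neq_1: "\<omega> \<noteq> 1"
begin

lemma omega_sum: "1 + \<omega> + \<omega> ^ 2 = 0"
proof -
  have "(\<omega> - 1) * (1 + \<omega> + \<omega> ^ 2) = \<omega> ^ 3 - 1"
    by (simp add: algebra_simps power2_eq_square power3_eq_cube)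
  then show ?thesis using omega_cube omega_neq_1 by simp
qed

text \<open>In characteristic three the square of \<open>\<omega> - 1\<close> would be zero.\<close>

lemma three_neq_0: "(3::'k) \<noteq> 0"
proof
  assume "(3::'k) = 0"
  then have "(\<omega> - 1) ^ 2 = 1 + \<omega> + \<omega> ^ 2 - 3 * \<omega>" "3 * \<omega> = 0"
    by (simp_all add: algebra_simps power2_eq_square)
  then show False using omega_sum omega_neq_1 by simp
qed

lemma omega_neq_0: "\<omega> \<noteq> 0"
  using omega_cube by auto

lemma omega_pow_mod: "\<omega> ^ (n mod 3) = \<omega> ^ n"
proof -
  have "\<omega> ^ n = (\<omega> ^ 3) ^ (n div 3) * \<omega> ^ (n mod 3)"
    by (simp flip: power_mult power_add)
  then show ?thesis by (simp add: omega_cube)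
qed

lemma omega_sq_neq_1: "\<omega> ^ 2 \<noteq> 1"
proof
  assume "\<omega> ^ 2 = 1"
  then have "\<omega> ^ 3 = \<omega>" by (simp add: power3_eq_cube power2_eq_square)
  then show False using omega_cube omega_neq_1 by simp
qed

lemma omega_pow_eq_1_iff: "\<omega> ^ n = 1 \<longleftrightarrow> 3 dvd n"
proof -
  have "n mod 3 = 0 \<or> n mod 3 = 1 \<or> n mod 3 = 2" by presburger
  then show ?thesis
    using omega_pow_mod[of n] omega_neq_1 omega_sq_neq_1
    by (elim disjE) (auto simp: dvd_eq_mod_eq_0)
qed

lemma omega_pow_eq_iff: "\<omega> ^ m = \<omega> ^ n \<longleftrightarrow> m mod 3 = n mod 3"
proof
  assume h: "\<omega> ^ m = \<omega> ^ n"
  have "\<omega> ^ (m + 2 * n) = \<omega> ^ (n + 2 * n)" using h by (simp only: power_add)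
  also have "n + 2 * n = 3 * n" by simp
  also have "\<omega> ^ (3 * n) = 1" by (simp only: omega_pow_eq_1_iff) simp
  finally have "3 dvd m + 2 * n" by (simp only: omega_pow_eq_1_iff)
  then show "m mod 3 = n mod 3" by presburger
qed (metis omega_pow_mod)

lemma cube_root_of_unity:
  assumes "u ^ 3 = 1"
  shows "\<exists>k<3. u = \<omega> ^ k"
proof -
  have "(u - 1) * (u - \<omega>) * (u - \<omega> ^ 2) = u ^ 3 - u ^ 2 * (1 + \<omega> + \<omega> ^ 2) +
      u * \<omega> * (1 + \<omega> + \<omega> ^ 2) - \<omega> ^ 3"
    by (simp add: algebra_simps power2_eq_square power3_eq_cube)
  also have "\<dots> = 0" by (simp add: omega_sum omega_cube assms)
  finally have "u = \<omega> ^ 0 \<or> u = \<omega> ^ 1 \<or> u = \<omega> ^ 2" by simp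
  moreover have "(0::nat) < 3" "(1::nat) < 3" "(2::nat) < 3" by simp_all
  ultimately show ?thesis by blast
qed

lemma cube_eq_obtain:
  assumes "p ^ 3 = q ^ 3"
  obtains k where "q = \<omega> ^ k * p"
proof (cases "p = 0")
  case True
  then have "q = \<omega> ^ 0 * p" using assms by simp
  then show ?thesis by (rule that)
next
  case False
  then have "(q / p) ^ 3 = 1" using assms[symmetric] by (simp add: power_divide)
  then obtain k where "q / p = \<omega> ^ k" using cube_root_of_unity by blast
  then have "q = \<omega> ^ k * p" using False by (simp add: field_simps)
  then show ?thesis by (rule that)
qed

text \<open>An entry records a weight vector f: its weights i and j under b and c, and its values p
  and q at v and w. The conclusion provides one group element that carries all values at v to those
  at w. The entry for the constant 1 makes \<open>quad\<close> cover shorter products too.\<close>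

lemma sync_rank_2:
  fixes S :: "(nat \<times> nat \<times> 'k \<times> 'k) set"
  assumes zero: "(0, 0, 1, 1) \<in> S"
    and quad: "\<And>i1 j1 p1 q1 i2 j2 p2 q2 i3 j3 p3 q3 i4 j4 p4 q4.
      (i1, j1, p1, q1) \<in> S \<Longrightarrow> (i2, j2, p2, q2) \<in> S \<Longrightarrow> (i3, j3, p3, q3) \<in> S \<Longrightarrow>
      (i4, j4, p4, q4) \<in> S \<Longrightarrow> 3 dvd i1 + i2 + i3 + i4 \<Longrightarrow> 3 dvd j1 + j2 + j3 + j4 \<Longrightarrow>
      p1 * p2 * p3 * p4 = q1 * q2 * q3 * q4"
  shows "\<exists>x y. \<forall>(i, j, p, q)\<in>S. q = \<omega> ^ (x * i + y * j) * p"
proof -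
  have cube: "p ^ 3 = q ^ 3" if "(i, j, p, q) \<in> S" for i j p q
  proof -
    have "3 dvd 0 + i + i + i" "3 dvd 0 + j + j + j" by presburger+
    from quad[OF zero that that that this] show ?thesis by (simp add: power3_eq_cube)
  qed
  \<comment> \<open>Only entries with p nonzero determine an exponent k mod 3; for the others
    \<open>cube\<close> gives q = 0.\<close>
  define T where "T = {(int i, int j, int k) | i j k. \<exists>p q. (i, j, p, q) \<in> S \<and> p \<noteq> 0 \<and> q = \<omega> ^ k * p}"
  have "\<exists>x y. \<forall>(i, j, k)\<in>T. 3 dvd k - (x * i + y * j)"
  proof (rule cong3_linear)
    have "(int 0, int 0, int 0) \<in> T"
      unfolding T_def using zero by force
    then show "(0, 0, 0) \<in> T" by simp
  next
    fix i1 j1 k1 i2 j2 k2 i3 j3 k3 i4 j4 k4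
    assume t: "(i1, j1, k1) \<in> T" "(i2, j2, k2) \<in> T" "(i3, j3, k3) \<in> T" "(i4, j4, k4) \<in> T"
      and d: "3 dvd i1 + i2 + i3 + i4" "3 dvd j1 + j2 + j3 + j4"
    obtain m1 n1 l1 p1 where 1: "i1 = int m1" "j1 = int n1" "k1 = int l1" "p1 \<noteq> 0"
      "(m1, n1, p1, \<omega> ^ l1 * p1) \<in> S" using t(1) unfolding T_def by auto
    obtain m2 n2 l2 p2 where 2: "i2 = int m2" "j2 = int n2" "k2 = int l2" "p2 \<noteq> 0"
      "(m2, n2, p2, \<omega> ^ l2 * p2) \<in> S" using t(2) unfolding T_def by auto
    obtain m3 n3 l3 p3 where 3: "i3 = int m3" "j3 = int n3" "k3 = int l3" "p3 \<noteq> 0"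
      "(m3, n3, p3, \<omega> ^ l3 * p3) \<in> S" using t(3) unfolding T_def by auto
    obtain m4 n4 l4 p4 where 4: "i4 = int m4" "j4 = int n4" "k4 = int l4" "p4 \<noteq> 0"
      "(m4, n4, p4, \<omega> ^ l4 * p4) \<in> S" using t(4) unfolding T_def by auto
    have "3 dvd m1 + m2 + m3 + m4" "3 dvd n1 + n2 + n3 + n4"
      using d unfolding 1 2 3 4 by presburger+
    from quad[OF 1(5) 2(5) 3(5) 4(5) this]
    have "\<omega> ^ (l1 + l2 + l3 + l4) * (p1 * p2 * p3 * p4) = p1 * p2 * p3 * p4"
      by (simp add: power_add mult_ac)
    then have "\<omega> ^ (l1 + l2 + l3 + l4) = 1" using 1 2 3 4 by simp
    then have "3 dvd l1 + l2 + l3 + l4" by (simp only: omega_pow_eq_1_iff)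
    then show "3 dvd k1 + k2 + k3 + k4" unfolding 1 2 3 4 by presburger
  qed
  then obtain x y where xy: "\<forall>(i, j, k)\<in>T. 3 dvd k - (x * i + y * j)" by blast
  have "q = \<omega> ^ (nat (x mod 3) * i + nat (y mod 3) * j) * p" if s: "(i, j, p, q) \<in> S" for i j p q
  proof (cases "p = 0")
    case True
    then show ?thesis using cube[OF s] by simp
  next
    case False
    obtain k where k: "q = \<omega> ^ k * p" using cube[OF s] by (rule cube_eq_obtain)
    have "(int i, int j, int k) \<in> T" unfolding T_def using s False k by blast
    then have d: "3 dvd int k - (x * int i + y * int j)" using xy by blast
    define N where "N = nat (x mod 3) * i + nat (y mod 3) * j"
    obtain x' y' where x': "x = int (nat (x mod 3)) + 3 * x'" and y': "y = int (nat (y mod 3)) + 3 * y'"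
      by (metis mod_mult_div_eq nat_0_le pos_mod_sign zero_less_numeral)
    have "int k - int N = (int k - (x * int i + y * int j)) + 3 * (x' * int i + y' * int j)"
      by (subst x', subst y') (simp add: N_def algebra_simps)
    then have "3 dvd int k - int N" using d by (metis dvd_add dvd_triv_left)
    then have "k mod 3 = N mod 3" by presburger
    then show ?thesis using k omega_pow_eq_iff unfolding N_def by auto
  qed
  then show ?thesis by blast
qed

text \<open>Two nontrivial residues mod 3 are equal or opposite, so three factors suffice to compare
  any entry with one fixed nonvanishing entry of nontrivial weight.\<close>

lemma sync_rank_1:
  fixes S :: "(nat \<times> 'k \<times> 'k) set"
  assumes zero: "(0, 1, 1) \<in> S"
    and triple: "\<And>i1 p1 q1 i2 p2 q2 i3 p3 q3.
      (i1, p1, q1) \<in> S \<Longrightarrow> (i2, p2, q2) \<in> S \<Longrightarrow> (i3, p3, q3) \<in> S \<Longrightarrow>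
      3 dvd i1 + i2 + i3 \<Longrightarrow> p1 * p2 * p3 = q1 * q2 * q3"
  shows "\<exists>x. \<forall>(i, p, q)\<in>S. q = \<omega> ^ (x * i) * p"
proof -
  have cube: "p ^ 3 = q ^ 3" if "(i, p, q) \<in> S" for i p q
  proof -
    have "3 dvd i + i + i" by presburger
    from triple[OF that that that this] show ?thesis by (simp add: power3_eq_cube)
  qed
  show ?thesis
  proof (cases "\<exists>i p q. (i, p, q) \<in> S \<and> \<not> 3 dvd i \<and> p \<noteq> 0")
    case True
    obtain m p0 q0 where s0: "(m, p0, q0) \<in> S" "\<not> 3 dvd m" "p0 \<noteq> 0" using True by blast
    obtain l where l: "q0 = \<omega> ^ l * p0" using cube[OF s0(1)] by (rule cube_eq_obtain)
    \<comment> \<open>The exponent has to send the weight m to l; as m is its own inverse mod 3, it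
      is \<open>m * l\<close>.\<close>
    have "q = \<omega> ^ (m * l * i) * p" if s: "(i, p, q) \<in> S" for i p q
    proof (cases "p = 0")
      case True
      then show ?thesis using cube[OF s] by simp
    next
      case False
      obtain k where k: "q = \<omega> ^ k * p" using cube[OF s] by (rule cube_eq_obtain)
      have gen: "(m * l * i) mod 3 = ((m mod 3) * (l mod 3) * (i mod 3)) mod 3"
        using mod_mult_eq[of "m * l" 3 i] mod_mult_eq[of m 3 l]
          mod_mult_left_eq[of "m mod 3 * (l mod 3)" 3 "i mod 3"] by metis
      have m: "m mod 3 = 1 \<or> m mod 3 = 2" using s0(2) by presburger
      have l3: "l mod 3 = 0 \<or> l mod 3 = 1 \<or> l mod 3 = 2" by presburger
      have "i mod 3 = 0 \<or> i mod 3 = m mod 3 \<or> i mod 3 = (2 * m) mod 3"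
        using s0(2) by presburger
      then have "k mod 3 = (m * l * i) mod 3"
      proof (elim disjE)
        assume i: "i mod 3 = 0"
        then have "\<omega> ^ k = 1" using triple[OF zero zero s] k False by (simp add: dvd_eq_mod_eq_0)
        then have "3 dvd k" by (simp add: omega_pow_eq_1_iff)
        moreover have "3 dvd m * l * i" using i by (intro dvd_mult) presburger
        ultimately show ?thesis by (metis dvd_imp_mod_0)
      next
        assume i: "i mod 3 = m mod 3"
        then have "3 dvd i + m + m" by presburger
        from triple[OF s s0(1) s0(1) this] have "\<omega> ^ (k + 2 * l) * (p * p0 * p0) = p * p0 * p0"
          unfolding k l by (simp add: power_add mult_ac mult_2_right)
        then have "\<omega> ^ (k + 2 * l) = 1" using False s0(3) by simp
        then have "3 dvd k + 2 * l" by (simp only: omega_pow_eq_1_iff)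
        then have 1: "k mod 3 = l mod 3" by presburger
        show ?thesis unfolding gen 1 i using m l3 by (elim disjE; simp)
      next
        assume i: "i mod 3 = (2 * m) mod 3"
        then have "3 dvd 0 + i + m" by presburger
        from triple[OF zero s s0(1) this] have "\<omega> ^ (k + l) * (p * p0) = p * p0"
          unfolding k l by (simp add: power_add mult_ac)
        then have "\<omega> ^ (k + l) = 1" using False s0(3) by simp
        then have "3 dvd k + l" by (simp only: omega_pow_eq_1_iff)
        then have 1: "k mod 3 = (2 * l) mod 3" by presburger
        have 2: "i mod 3 = (2 * (m mod 3)) mod 3" "k mod 3 = (2 * (l mod 3)) mod 3"
          using i 1 by (simp_all add: mod_mult_right_eq)
        show ?thesis unfolding gen 2 using m l3 by (elim disjE; simp)
      qed
      then show ?thesis using k omega_pow_eq_iff by auto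
    qed
    then show ?thesis by blast
  next
    case False
    have "q = \<omega> ^ (0 * i) * p" if s: "(i, p, q) \<in> S" for i p q
    proof (cases "3 dvd i")
      case True
      then show ?thesis using triple[OF zero zero s] by simp
    next
      case nd: False
      then have "p = 0" using False s by blast
      then show ?thesis using cube[OF s] by simp
    qed
    then show ?thesis by blast
  qed
qed

end

section \<open>Polynomial functions on a Heisenberg representation\<close>

text \<open>The degree is a bound carried along with the construction of a function, since over a
  finite field different formal polynomials may define the same function. Points belong to an
  arbitrary type; \<open>Lin\<close> tells which functions count as linear.\<close>

inductive pol :: "('v \<Rightarrow> 'k::comm_ring_1) set \<Rightarrow> nat \<Rightarrow> ('v \<Rightarrow> 'k) \<Rightarrow> bool" for Lin where
  pol_const: "pol Lin d (\<lambda>_. k)"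
| pol_lin: "f \<in> Lin \<Longrightarrow> pol Lin 1 f"
| pol_mono: "pol Lin d f \<Longrightarrow> d \<le> e \<Longrightarrow> pol Lin e f"
| pol_add: "pol Lin d f \<Longrightarrow> pol Lin d g \<Longrightarrow> pol Lin d (\<lambda>x. f x + g x)"
| pol_mult: "pol Lin d f \<Longrightarrow> pol Lin e g \<Longrightarrow> pol Lin (d + e) (\<lambda>x. f x * g x)"

lemma pol_scale: "pol Lin d f \<Longrightarrow> pol Lin d (\<lambda>x. k * f x)"
  using pol_mult[OF pol_const[of Lin 0 k], of d f] by simp

lemma pol_mult_le: "pol Lin d f \<Longrightarrow> pol Lin e g \<Longrightarrow> d + e \<le> n \<Longrightarrow> pol Lin n (\<lambda>x. f x * g x)"
  by (rule pol_mono[OF pol_mult])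

lemma pol_pow: "pol Lin d f \<Longrightarrow> pol Lin (n * d) (\<lambda>x. f x ^ n)"
proof (induction n)
  case 0
  then show ?case using pol_const[of Lin 0 1] by simp
next
  case (Suc n)
  then show ?case using pol_mult[of Lin d f "n * d" "\<lambda>x. f x ^ n"] by simp
qed

lemma pol_comp:
  assumes "\<And>f. f \<in> Lin \<Longrightarrow> (\<lambda>x. f (g x)) \<in> Lin" and "pol Lin d f"
  shows "pol Lin d (\<lambda>x. f (g x))"
  using assms(2)
  by (induction rule: pol.induct) (auto intro: pol_const pol_mono pol_add pol_mult pol_lin[unfolded One_nat_def] assms(1))

section \<open>Weight components under an operator of order three\<close>

context cube_root
begin

text \<open>Projection to the eigenvalue \<open>\<omega> ^ i\<close> of composition with g. The
  exponents \<open>2 * i\<close> and \<open>i\<close> stand for -i and -2i, which keeps them natural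
  numbers.\<close>

definition weight_part :: "('v \<Rightarrow> 'v) \<Rightarrow> nat \<Rightarrow> ('v \<Rightarrow> 'k) \<Rightarrow> 'v \<Rightarrow> 'k" where
  "weight_part g i f = (\<lambda>x. (1 / 3) * (f x + \<omega> ^ (2 * i) * f (g x) + \<omega> ^ i * f (g (g x))))"

lemma weight_part_sum: "f x = weight_part g 0 f x + weight_part g 1 f x + weight_part g 2 f x"
proof -
  have w4: "\<omega> ^ 4 = \<omega>" using omega_pow_mod[of 4] by simp
  have "t * (y + y' + y'') + t * (y + \<omega> ^ 2 * y' + \<omega> * y'') + t * (y + \<omega> ^ 4 * y' + \<omega> ^ 2 * y'') =
      t * (3 * y + (1 + \<omega> + \<omega> ^ 2) * (y' + y''))" for t y y' y''
    by (simp add: w4 algebra_simps)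
  from this[of "1 / 3" "f x" "f (g x)" "f (g (g x))"] show ?thesis
    using three_neq_0 by (simp add: weight_part_def omega_sum)
qed

lemma weight_part_eigen:
  assumes "\<And>x. g (g (g x)) = x"
  shows "weight_part g i f (g x) = \<omega> ^ i * weight_part g i f x"
proof -
  have "\<omega> ^ i * \<omega> ^ (2 * i) = (\<omega> ^ 3) ^ i" by (simp flip: power_add power_mult)
  then have 1: "\<omega> ^ i * (\<omega> ^ (2 * i) * y) = y" for y by (simp add: omega_cube flip: mult.assoc)
  have 2: "\<omega> ^ i * (\<omega> ^ i * y) = \<omega> ^ (2 * i) * y" for y by (simp add: mult_2 power_add mult.assoc)
  show ?thesis
    by (simp add: weight_part_def assms distrib_left mult.left_commute[of "\<omega> ^ i" "1 / 3"] 1 2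
        del: times_divide_eq_left)
qed

lemma weight_part_eigen_other:
  assumes "\<And>x. f (h x) = \<mu> * f x" "\<And>x. f (g (h x)) = \<mu> * f (g x)" "\<And>x. f (g (g (h x))) = \<mu> * f (g (g x))"
  shows "weight_part g i f (h x) = \<mu> * weight_part g i f x"
  by (simp add: weight_part_def assms algebra_simps)

lemma pol_weight_part:
  assumes "\<And>f. f \<in> Lin \<Longrightarrow> (\<lambda>x. f (g x)) \<in> Lin" and "pol Lin d f"
  shows "pol Lin d (weight_part g i f)"
  unfolding weight_part_def
  using pol_comp[OF assms] pol_comp[OF assms(1) pol_comp[OF assms]]
  by (intro pol_scale pol_add assms(2))

lemma eigen_funpow: "(\<And>x. f (g x) = \<omega> ^ i * f x) \<Longrightarrow> f ((g ^^ n) x) = \<omega> ^ (n * i) * f x"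
  by (induction n) (simp_all add: power_add mult_ac)

end

text \<open>The relation \<open>ab\<close> is the commutator relation with inverses cleared. Nothing
  is assumed about the points, so the locale can be instantiated again with other generators of the
  same group.\<close>

locale heis_action = cube_root \<omega> for \<omega> :: "'k::field" +
  fixes a b c :: "'v \<Rightarrow> 'v" and Lin :: "('v \<Rightarrow> 'k) set"
  assumes a3: "a (a (a x)) = x" and b3: "b (b (b x)) = x" and c3: "c (c (c x)) = x"
    and ab: "a (b x) = b (a (c x))" and ac: "a (c x) = c (a x)" and bc: "b (c x) = c (b x)"
    and Lin_add: "f \<in> Lin \<Longrightarrow> g \<in> Lin \<Longrightarrow> (\<lambda>x. f x + g x) \<in> Lin"
    and Lin_scale: "f \<in> Lin \<Longrightarrow> (\<lambda>x. k * f x) \<in> Lin"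
    and Lin_a: "f \<in> Lin \<Longrightarrow> (\<lambda>x. f (a x)) \<in> Lin"
    and Lin_b: "f \<in> Lin \<Longrightarrow> (\<lambda>x. f (b x)) \<in> Lin"
    and Lin_c: "f \<in> Lin \<Longrightarrow> (\<lambda>x. f (c x)) \<in> Lin"
begin

definition agree :: "'v \<Rightarrow> 'v \<Rightarrow> bool" where
  "agree v w \<longleftrightarrow> (\<forall>f. pol Lin 9 f \<longrightarrow> (\<forall>x. f (a x) = f x) \<longrightarrow> (\<forall>x. f (b x) = f x) \<longrightarrow>
     (\<forall>x. f (c x) = f x) \<longrightarrow> f v = f w)"

text \<open>Inverses of the generators are their squares, so forward steps already yield the whole
  orbit.\<close>

inductive_set orb :: "'v \<Rightarrow> 'v set" for v where
  orb_self: "v \<in> orb v"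
| orb_a: "x \<in> orb v \<Longrightarrow> a x \<in> orb v"
| orb_b: "x \<in> orb v \<Longrightarrow> b x \<in> orb v"
| orb_c: "x \<in> orb v \<Longrightarrow> c x \<in> orb v"

lemma orb_pow:
  "x \<in> orb v \<Longrightarrow> (a ^^ n) x \<in> orb v"
  "x \<in> orb v \<Longrightarrow> (b ^^ n) x \<in> orb v"
  "x \<in> orb v \<Longrightarrow> (c ^^ n) x \<in> orb v"
  by (induction n) (auto intro: orb.intros)

lemma Lin_weight_part:
  assumes "f \<in> Lin"
  shows "weight_part a i f \<in> Lin" "weight_part b i f \<in> Lin" "weight_part c i f \<in> Lin"
  unfolding weight_part_def
  using assms by (intro Lin_scale Lin_add Lin_a Lin_b Lin_c; assumption)+

text \<open>The family M stays abstract because it is used twice: with all weight vectors of degree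
  at most one, and with those of a single nontrivial c-weight, where the equations
  \<open>quad\<close> come from cubic invariants.\<close>

lemma bc_sync:
  assumes M: "\<And>i j f. (i, j, f) \<in> M \<Longrightarrow> (\<forall>x. f (b x) = \<omega> ^ i * f x) \<and> (\<forall>x. f (c x) = \<omega> ^ j * f x)"
    and one: "(0, 0, \<lambda>_. 1) \<in> M"
    and quad: "\<And>i1 j1 f1 i2 j2 f2 i3 j3 f3 i4 j4 f4.
      (i1, j1, f1) \<in> M \<Longrightarrow> (i2, j2, f2) \<in> M \<Longrightarrow> (i3, j3, f3) \<in> M \<Longrightarrow> (i4, j4, f4) \<in> M \<Longrightarrow>
      3 dvd i1 + i2 + i3 + i4 \<Longrightarrow> 3 dvd j1 + j2 + j3 + j4 \<Longrightarrow>
      f1 v * f2 v * f3 v * f4 v = f1 w * f2 w * f3 w * f4 w"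
  shows "\<exists>m n. \<forall>(i, j, f)\<in>M. f ((b ^^ m) ((c ^^ n) v)) = f w"
proof -
  define S where "S = (\<lambda>(i, j, f). (i, j, f v, f w)) ` M"
  have "\<exists>m n. \<forall>(i, j, p, q)\<in>S. q = \<omega> ^ (m * i + n * j) * p"
  proof (rule sync_rank_2)
    show "(0, 0, 1, 1) \<in> S" using one unfolding S_def by force
  next
    fix i1 j1 p1 q1 i2 j2 p2 q2 i3 j3 p3 q3 i4 j4 p4 q4
    assume "(i1, j1, p1, q1) \<in> S" "(i2, j2, p2, q2) \<in> S" "(i3, j3, p3, q3) \<in> S" "(i4, j4, p4, q4) \<in> S"
      and d: "3 dvd i1 + i2 + i3 + i4" "3 dvd j1 + j2 + j3 + j4"
    then obtain f1 f2 f3 f4 where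
      "(i1, j1, f1) \<in> M" "p1 = f1 v" "q1 = f1 w" "(i2, j2, f2) \<in> M" "p2 = f2 v" "q2 = f2 w"
      "(i3, j3, f3) \<in> M" "p3 = f3 v" "q3 = f3 w" "(i4, j4, f4) \<in> M" "p4 = f4 v" "q4 = f4 w"
      unfolding S_def by auto
    then show "p1 * p2 * p3 * p4 = q1 * q2 * q3 * q4"
      using quad[OF _ _ _ _ d] by blast
  qed
  then obtain m n where mn: "\<forall>(i, j, p, q)\<in>S. q = \<omega> ^ (m * i + n * j) * p" by blast
  have "f ((b ^^ m) ((c ^^ n) v)) = f w" if f: "(i, j, f) \<in> M" for i j f
  proof -
    have "f w = \<omega> ^ (m * i + n * j) * f v" using mn f unfolding S_def by fastforce
    moreover have "f ((b ^^ m) ((c ^^ n) v)) = \<omega> ^ (m * i) * (\<omega> ^ (n * j) * f v)"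
      using eigen_funpow[of f b i m] eigen_funpow[of f c j n] M[OF f] by simp
    ultimately show ?thesis by (simp add: power_add)
  qed
  then show ?thesis by blast
qed

lemma Lin_agree_from_weights:
  assumes "\<And>i j f. f \<in> Lin \<Longrightarrow> (\<And>x. f (b x) = \<omega> ^ i * f x) \<Longrightarrow> (\<And>x. f (c x) = \<omega> ^ j * f x) \<Longrightarrow>
      j < 3 \<Longrightarrow> f y = f w"
    and f: "f \<in> Lin"
  shows "f y = f w"
proof -
  have p: "weight_part b i (weight_part c j f) y = weight_part b i (weight_part c j f) w"
    if "j < 3" for i j
  proof (rule assms(1)[OF _ _ _ that])
    show "weight_part b i (weight_part c j f) \<in> Lin" by (intro Lin_weight_part f)
    show "weight_part b i (weight_part c j f) (b x) = \<omega> ^ i * weight_part b i (weight_part c j f) x" for x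
      by (rule weight_part_eigen) (rule b3)
    show "weight_part b i (weight_part c j f) (c x) = \<omega> ^ j * weight_part b i (weight_part c j f) x" for x
      by (rule weight_part_eigen_other) (simp_all add: bc weight_part_eigen[of c] c3)
  qed
  have q: "weight_part c j f y = weight_part c j f w" if "j < 3" for j
    using p[OF that] weight_part_sum[of "weight_part c j f" _ b] by metis
  show ?thesis
    using q[of 0] q[of 1] q[of 2] weight_part_sum[of f _ c] by simp
qed

lemma bc_sync_all:
  assumes "\<And>f. pol Lin 4 f \<Longrightarrow> (\<And>x. f (b x) = f x) \<Longrightarrow> (\<And>x. f (c x) = f x) \<Longrightarrow> f v = f w"
  shows "\<exists>m n. \<forall>f\<in>Lin. f ((b ^^ m) ((c ^^ n) v)) = f w"
proof -
  \<comment> \<open>Degree at most one, instead of membership in \<open>Lin\<close>, admits the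
    constant 1.\<close>
  define M where "M = {(i, j, f) | i j f. pol Lin 1 f \<and> (\<forall>x. f (b x) = \<omega> ^ i * f x) \<and> (\<forall>x. f (c x) = \<omega> ^ j * f x)}"
  have "\<exists>m n. \<forall>(i, j, f)\<in>M. f ((b ^^ m) ((c ^^ n) v)) = f w"
  proof (rule bc_sync)
    show "(0, 0, \<lambda>_. 1) \<in> M" unfolding M_def by (auto intro: pol_const)
  next
    fix i1 j1 f1 i2 j2 f2 i3 j3 f3 i4 j4 f4
    assume m: "(i1, j1, f1) \<in> M" "(i2, j2, f2) \<in> M" "(i3, j3, f3) \<in> M" "(i4, j4, f4) \<in> M"
      and d: "3 dvd i1 + i2 + i3 + i4" "3 dvd j1 + j2 + j3 + j4"
    note e = d[folded omega_pow_eq_1_iff]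
    have "pol Lin (1 + 1 + 1 + 1) (\<lambda>x. f1 x * f2 x * f3 x * f4 x)"
      using m unfolding M_def by (intro pol_mult) auto
    then have p: "pol Lin 4 (\<lambda>x. f1 x * f2 x * f3 x * f4 x)" by (rule pol_mono) simp
    have "f1 (b x) * f2 (b x) * f3 (b x) * f4 (b x) = \<omega> ^ (i1 + i2 + i3 + i4) * (f1 x * f2 x * f3 x * f4 x)" for x
      using m unfolding M_def by (simp add: power_add mult_ac)
    moreover have "f1 (c x) * f2 (c x) * f3 (c x) * f4 (c x) = \<omega> ^ (j1 + j2 + j3 + j4) * (f1 x * f2 x * f3 x * f4 x)" for x
      using m unfolding M_def by (simp add: power_add mult_ac)
    ultimately show "f1 v * f2 v * f3 v * f4 v = f1 w * f2 w * f3 w * f4 w"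
      using assms[OF p] unfolding e by simp
  qed (auto simp: M_def)
  then obtain m n where mn: "\<forall>(i, j, f)\<in>M. f ((b ^^ m) ((c ^^ n) v)) = f w" by blast
  have "f ((b ^^ m) ((c ^^ n) v)) = f w" if "f \<in> Lin" for f
    using that
  proof (rule Lin_agree_from_weights[rotated])
    fix i j and f :: "'v \<Rightarrow> 'k"
    assume "f \<in> Lin" "\<And>x. f (b x) = \<omega> ^ i * f x" "\<And>x. f (c x) = \<omega> ^ j * f x"
    then have "(i, j, f) \<in> M" unfolding M_def using pol_lin by blast
    then show "f ((b ^^ m) ((c ^^ n) v)) = f w" using mn by blast
  qed
  then show ?thesis by blast
qed

text \<open>The subgroup generated by b and c is normal, so translation by a preserves invariance
  under it.\<close>

lemma bc_invariant_weight_part_a: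
  assumes "\<And>x. f (b x) = f x" "\<And>x. f (c x) = f x"
  shows "weight_part a i f (b x) = weight_part a i f x" "weight_part a i f (c x) = weight_part a i f x"
proof -
  have "f (a (c x)) = f (a x)" "f (a (a (c x))) = f (a (a x))" for x
    by (simp_all add: ac assms)
  then show "weight_part a i f (b x) = weight_part a i f x" "weight_part a i f (c x) = weight_part a i f x"
    by (simp_all add: weight_part_def ab assms)
qed

lemma agree_shift: "agree v w \<Longrightarrow> agree ((a ^^ n) v) w"
proof -
  have "f ((a ^^ n) v) = f v" if "\<And>x. f (a x) = f x" for f :: "'v \<Rightarrow> 'k"
    by (induction n) (simp_all add: that)
  then show "agree v w \<Longrightarrow> agree ((a ^^ n) v) w" unfolding agree_def by metis
qed

lemma agreeD:
  "agree v w \<Longrightarrow> pol Lin d f \<Longrightarrow> d \<le> 9 \<Longrightarrow> (\<And>x. f (a x) = f x) \<Longrightarrow> (\<And>x. f (b x) = f x) \<Longrightarrow>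
   (\<And>x. f (c x) = f x) \<Longrightarrow> f v = f w"
  unfolding agree_def using pol_mono by blast

text \<open>Multiplying an \<open>a\<close>-eigencomponent of a \<open>\<langle>b, c\<rangle>\<close>-invariant of degree at most four by a power
  of \<open>f\<close> makes it invariant, so the \<open>\<langle>b, c\<rangle>\<close>-invariants agree as soon as \<open>f\<close> does.\<close>

lemma separate_by_semiinvariant:
  assumes agr: "agree v w" and f: "pol Lin 2 f" and fa: "\<And>x. f (a x) = \<omega> ^ r * f x" and r: "\<not> 3 dvd r"
    and fb: "\<And>x. f (b x) = f x" and fv: "f v \<noteq> 0"
  shows "\<exists>x\<in>orb v. \<forall>f\<in>Lin. f x = f w"
proof -
  \<comment> \<open>A commutator acts trivially on every semi-invariant.\<close>
  have fc: "f (c x) = f x" for x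
  proof -
    have "\<omega> ^ r * f x = f (a (b x))" by (simp add: fa fb)
    also have "\<dots> = \<omega> ^ r * f (c x)" unfolding ab by (simp add: fa fb)
    finally show ?thesis using omega_neq_0 by simp
  qed
  have rr: "(r * r) mod 3 = 1"
  proof -
    have "r mod 3 = 1 \<or> r mod 3 = 2" using r by presburger
    then show ?thesis using mod_mult_eq[of r 3 r] by auto
  qed
  have pw: "\<omega> ^ (3 * n) = 1" for n by (simp add: omega_pow_eq_1_iff)
  have "f v ^ 3 = f w ^ 3"
  proof (rule agreeD[OF agr pol_pow[OF f, of 3]])
    show "f (a x) ^ 3 = f x ^ 3" for x
      by (simp add: fa power_mult_distrib omega_cube mult.commute[of _ 3] flip: power_mult) (simp add: pw)
  qed (simp_all add: fb fc)
  then obtain k where k: "f w = \<omega> ^ k * f v" by (rule cube_eq_obtain)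
  \<comment> \<open>This shift multiplies f v by \<open>\<omega> ^ (r * k * r)\<close>, which is
    \<open>\<omega> ^ k\<close> because r * r = 1 mod 3; thus f takes the value f w at v'.\<close>
  define v' where "v' = (a ^^ (r * k)) v"
  have fv': "f v' = f w"
  proof -
    have "(r * k * r) mod 3 = (r * r * k) mod 3" by (simp add: mult_ac)
    also have "\<dots> = k mod 3" using rr by (metis mod_mult_left_eq mult_1)
    finally have "\<omega> ^ (r * k * r) = \<omega> ^ k" by (simp add: omega_pow_eq_iff)
    then show ?thesis unfolding v'_def k using eigen_funpow[of f a r "r * k" v] fa by simp
  qed
  have fw0: "f w \<noteq> 0" using k fv omega_neq_0 by simp
  have agr': "agree v' w" unfolding v'_def using agr by (rule agree_shift)
  have "\<exists>m n. \<forall>f\<in>Lin. f ((b ^^ m) ((c ^^ n) v')) = f w"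
  proof (rule bc_sync_all)
    fix h assume h: "pol Lin 4 h" and hb: "\<And>x. h (b x) = h x" and hc: "\<And>x. h (c x) = h x"
    have "weight_part a i h v' = weight_part a i h w" for i
    proof -
      let ?h = "weight_part a i h"
      \<comment> \<open>Solves i + r * n = 0 mod 3, since \<open>2 * r\<close> is -1/r. As n is at
        most 2, the degree stays within 4 + 2 * 2 = 8.\<close>
      define n where "n = (2 * r * i) mod 3"
      have "pol Lin 4 ?h" using pol_weight_part[of Lin a, OF Lin_a h] by blast
      from pol_mult[OF this pol_pow[OF f, of n]]
      have p: "pol Lin (4 + n * 2) (\<lambda>x. ?h x * f x ^ n)" .
      have w: "\<omega> ^ (i + r * n) = 1"
      proof -
        have "r * n mod 3 = (r * (2 * r * i)) mod 3" unfolding n_def by (rule mod_mult_right_eq)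
        also have "\<dots> = ((r * r) * (2 * i)) mod 3" by (simp add: mult_ac)
        also have "\<dots> = (2 * i) mod 3" using rr by (metis mod_mult_left_eq mult_1)
        finally have "3 dvd i + r * n" by presburger
        then show ?thesis by (simp only: omega_pow_eq_1_iff)
      qed
      have "?h v' * f v' ^ n = ?h w * f w ^ n"
      proof (rule agreeD[OF agr' p])
        have "n < 3" unfolding n_def by simp
        then show "4 + n * 2 \<le> 9" by simp
        show "?h (a x) * f (a x) ^ n = ?h x * f x ^ n" for x
        proof -
          have "?h (a x) * f (a x) ^ n = \<omega> ^ (i + r * n) * (?h x * f x ^ n)"
            by (simp add: weight_part_eigen a3 fa power_mult_distrib power_add mult_ac flip: power_mult)
          then show ?thesis by (simp add: w)
        qed
      qed (simp_all add: bc_invariant_weight_part_a[OF hb hc] fb fc)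
      then show ?thesis using fw0 by (simp add: fv')
    qed
    then show "h v' = h w" using weight_part_sum[of h _ a] by metis
  qed
  moreover have "v' \<in> orb v" unfolding v'_def by (intro orb_pow orb_self)
  ultimately show ?thesis by (blast intro: orb_pow)
qed

text \<open>On functions fixed by b and c only a quotient of order three, generated by a, still
  acts. Rank one synchronisation therefore applies, and its products of three cubic components
  exhaust the permitted degree nine.\<close>

lemma cubic_sync:
  assumes agr: "agree v w"
  shows "\<exists>n. \<forall>f. pol Lin 3 f \<longrightarrow> (\<forall>x. f (b x) = f x) \<longrightarrow> (\<forall>x. f (c x) = f x) \<longrightarrow> f ((a ^^ n) v) = f w"
proof -
  define S where "S = {(i, f v, f w) | i f. pol Lin 3 f \<and> (\<forall>x. f (a x) = \<omega> ^ i * f x) \<and>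
    (\<forall>x. f (b x) = f x) \<and> (\<forall>x. f (c x) = f x)}"
  have "\<exists>n. \<forall>(i, p, q)\<in>S. q = \<omega> ^ (n * i) * p"
  proof (rule sync_rank_1)
    show "(0, 1, 1) \<in> S" unfolding S_def
      by (rule CollectI, rule exI[of _ 0], rule exI[of _ "\<lambda>_. 1"]) (auto intro: pol_const)
  next
    fix i1 p1 q1 i2 p2 q2 i3 p3 q3
    assume "(i1, p1, q1) \<in> S" "(i2, p2, q2) \<in> S" "(i3, p3, q3) \<in> S" and d: "3 dvd i1 + i2 + i3"
    then obtain f1 f2 f3 where pq: "p1 = f1 v" "q1 = f1 w" "p2 = f2 v" "q2 = f2 w" "p3 = f3 v" "q3 = f3 w"
      and f: "pol Lin 3 f1" "pol Lin 3 f2" "pol Lin 3 f3"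
      and e: "\<And>x. f1 (a x) = \<omega> ^ i1 * f1 x" "\<And>x. f2 (a x) = \<omega> ^ i2 * f2 x" "\<And>x. f3 (a x) = \<omega> ^ i3 * f3 x"
      and i: "\<And>x. f1 (b x) = f1 x" "\<And>x. f2 (b x) = f2 x" "\<And>x. f3 (b x) = f3 x"
        "\<And>x. f1 (c x) = f1 x" "\<And>x. f2 (c x) = f2 x" "\<And>x. f3 (c x) = f3 x"
      unfolding S_def by auto
    show "p1 * p2 * p3 = q1 * q2 * q3"
      unfolding pq
    proof (rule agreeD[OF agr pol_mult[OF pol_mult[OF f(1,2)] f(3)]])
      show "f1 (a x) * f2 (a x) * f3 (a x) = f1 x * f2 x * f3 x" for x
      proof -
        have "f1 (a x) * f2 (a x) * f3 (a x) = \<omega> ^ (i1 + i2 + i3) * (f1 x * f2 x * f3 x)"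
          by (simp add: e power_add mult_ac)
        moreover have "\<omega> ^ (i1 + i2 + i3) = 1" using d by (simp only: omega_pow_eq_1_iff)
        ultimately show ?thesis by simp
      qed
    qed (simp_all add: i)
  qed
  then obtain n where n: "\<forall>(i, p, q)\<in>S. q = \<omega> ^ (n * i) * p" by blast
  have "f ((a ^^ n) v) = f w" if f: "pol Lin 3 f" and i: "\<And>x. f (b x) = f x" "\<And>x. f (c x) = f x" for f
  proof -
    have "weight_part a i f ((a ^^ n) v) = weight_part a i f w" for i
    proof -
      let ?f = "weight_part a i f"
      have e: "?f (a x) = \<omega> ^ i * ?f x" for x by (rule weight_part_eigen) (rule a3)
      have "(i, ?f v, ?f w) \<in> S"
        unfolding S_def using pol_weight_part[of Lin a, OF Lin_a f] e bc_invariant_weight_part_a[OF i] by blast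
      then have "?f w = \<omega> ^ (n * i) * ?f v" using n by blast
      then show ?thesis using eigen_funpow[of ?f a i n v] e by simp
    qed
    then show ?thesis using weight_part_sum[of f _ a] by metis
  qed
  then show ?thesis by blast
qed

section \<open>Points at which the semi-invariants of low degree vanish\<close>

lemma eigen_orb_zero:
  assumes "\<And>x. f (a x) = \<omega> ^ r * f x" "\<And>x. f (b x) = \<omega> ^ u * f x" "\<And>x. f (c x) = f x"
    and "f v = 0" and "x \<in> orb v"
  shows "f x = 0"
  using assms(5) by (induction rule: orb.induct) (simp_all add: assms)

lemma invariant_orb:
  assumes "\<And>x. f (a x) = f x" "\<And>x. f (b x) = f x" "\<And>x. f (c x) = f x" and "x \<in> orb v"
  shows "f x = f v"
  using assms(4) by (induction rule: orb.induct) (simp_all add: assms)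

lemma c_invariant_weight_part:
  assumes "\<And>x. f (c x) = f x"
  shows "weight_part a r f (c x) = weight_part a r f x" "weight_part b u f (c x) = weight_part b u f x"
    "(\<And>x. f (b x) = \<omega> ^ u * f x) \<Longrightarrow> weight_part a r f (b x) = \<omega> ^ u * weight_part a r f x"
proof -
  have 1: "f (a (c x)) = f (a x)" "f (a (a (c x))) = f (a (a x))"
    "f (b (c x)) = f (b x)" "f (b (b (c x))) = f (b (b x))" for x
    by (simp_all add: ac bc assms)
  then show "weight_part a r f (c x) = weight_part a r f x" "weight_part b u f (c x) = weight_part b u f x"
    by (simp_all add: weight_part_def assms)
  assume "\<And>x. f (b x) = \<omega> ^ u * f x"
  then show "weight_part a r f (b x) = \<omega> ^ u * weight_part a r f x"
    by (intro weight_part_eigen_other) (simp_all add: ab 1)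
qed

text \<open>Choose \<open>h\<close> in the \<open>a\<close>-orbit of \<open>g\<close> with \<open>b\<close>-weight opposite to that of \<open>f\<close>. By \<open>H\<close>, the products
  of \<open>f\<close> with the other two translates of \<open>h\<close> vanish at \<open>v\<close>, and \<open>f h\<close> takes the same value at
  \<open>v\<close> and \<open>a v\<close>.\<close>

lemma c_weight_1_or_2_vanishes:
  assumes H: "\<And>f r u. pol Lin 2 f \<Longrightarrow> (\<And>x. f (a x) = \<omega> ^ r * f x) \<Longrightarrow> (\<And>x. f (b x) = \<omega> ^ u * f x) \<Longrightarrow>
      \<not> (3 dvd r \<and> 3 dvd u) \<Longrightarrow> f v = 0"
    and f: "f \<in> Lin" "\<And>x. f (b x) = \<omega> ^ j * f x" "\<And>x. f (c x) = \<omega> * f x"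
    and g: "g \<in> Lin" "\<And>x. g (b x) = \<omega> ^ k * g x" "\<And>x. g (c x) = \<omega> ^ 2 * g x"
    and fv: "f v \<noteq> 0"
  shows "g v = 0"
proof -
  \<comment> \<open>The nontrivial b-weight alone makes \<open>H\<close> applicable to every
    a-weight component of \<open>\<phi>\<close>.\<close>
  have zero: "\<phi> v = 0" if p: "pol Lin 2 \<phi>" and c: "\<And>x. \<phi> (c x) = \<phi> x" and b: "\<And>x. \<phi> (b x) = \<omega> ^ u * \<phi> x"
      and u: "\<not> 3 dvd u" for \<phi> u
  proof -
    have "weight_part a r \<phi> v = 0" for r
      using pol_weight_part[of Lin a, OF Lin_a p] weight_part_eigen[of a r \<phi>, OF a3]
        c_invariant_weight_part(3)[OF c b] u by (intro H[of _ r u]) auto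
    then show ?thesis using weight_part_sum[of \<phi> v a] by simp
  qed
  \<comment> \<open>At v, and hence at a v, only the component of a-weight 0 survives, and this one
    is a-invariant.\<close>
  have same: "\<phi> (a v) = \<phi> v" if p: "pol Lin 2 \<phi>" and c: "\<And>x. \<phi> (c x) = \<phi> x" and b: "\<And>x. \<phi> (b x) = \<phi> x" for \<phi>
  proof -
    have e: "weight_part a r \<phi> (a x) = \<omega> ^ r * weight_part a r \<phi> x" for r x
      by (rule weight_part_eigen) (rule a3)
    have "weight_part a r \<phi> v = 0" if "\<not> 3 dvd r" for r
      using pol_weight_part[of Lin a, OF Lin_a p] e that
        c_invariant_weight_part(3)[of \<phi> 0 r] c b by (intro H[of _ r 0]) auto
    then have "weight_part a 1 \<phi> v = 0" "weight_part a 2 \<phi> v = 0" by simp_all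
    then show ?thesis using weight_part_sum[of \<phi> v a] weight_part_sum[of \<phi> "a v" a] by (simp add: e)
  qed
  have fg: "pol Lin 2 (\<lambda>x. f x * h x)" if "h \<in> Lin" for h
    by (rule pol_mult_le[OF pol_lin[OF f(1)] pol_lin[OF that]]) simp
  have g_a: "(\<lambda>x. h (a x)) \<in> Lin \<and> (\<forall>x. h (a (b x)) = \<omega> ^ (l + 2) * h (a x)) \<and> (\<forall>x. h (a (c x)) = \<omega> ^ 2 * h (a x))"
    if "h \<in> Lin" "\<And>x. h (b x) = \<omega> ^ l * h x" "\<And>x. h (c x) = \<omega> ^ 2 * h x" for h l
    using that Lin_a by (simp add: ab ac power_add power2_eq_square)
  have w3: "\<omega> * (\<omega> ^ 2 * y) = y" for y
    using omega_cube by (simp add: power3_eq_cube power2_eq_square flip: mult.assoc)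
  have w3': "\<omega> * \<omega> ^ 2 = 1"
    using omega_cube by (simp add: power3_eq_cube power2_eq_square mult.assoc)
  have w4: "\<omega> * (\<omega> * (\<omega> * \<omega>)) = \<omega> ^ 4" by (simp add: power4_eq_xxxx mult.assoc)
  have orbit_zero: "h v = 0 \<and> h (a v) = 0 \<and> h (a (a v)) = 0"
    if h: "h \<in> Lin" "\<And>x. h (b x) = \<omega> ^ l * h x" "\<And>x. h (c x) = \<omega> ^ 2 * h x" and l: "3 dvd j + l" for h l
  proof -
    note h1 = g_a[OF h]
    note h2 = g_a[of "\<lambda>x. h (a x)" "l + 2"]
    have "f v * h (a v) = 0"
    proof (rule zero[of _ "j + l + 2"])
      show "pol Lin 2 (\<lambda>x. f x * h (a x))" using h1 by (intro fg) auto
      show "\<not> 3 dvd j + l + 2" using l by presburger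
    qed (use h1 f in \<open>auto simp: power_add mult_ac w3 w3' w4\<close>)
    moreover have "f v * h (a (a v)) = 0"
    proof (rule zero[of _ "j + l + 4"])
      show "pol Lin 2 (\<lambda>x. f x * h (a (a x)))" using h1 h2 by (intro fg) auto
      show "\<not> 3 dvd j + l + 4" using l by presburger
    qed (use h1 h2 f in \<open>auto simp: power_add mult_ac w3 w3' w4\<close>)
    moreover have "f (a v) * h (a v) = f v * h v"
    proof (rule same)
      show "pol Lin 2 (\<lambda>x. f x * h x)" using h by (intro fg) auto
      have "\<omega> ^ (j + l) = 1" using l by (simp only: omega_pow_eq_1_iff)
      then show "f (b x) * h (b x) = f x * h x" for x
        using f h by (simp add: power_add mult_ac)
      show "f (c x) * h (c x) = f x * h x" for x
        using f h by (simp add: mult_ac w3 w3')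
    qed
    \<comment> \<open>Since h (a v) = 0, the last equation becomes f v * h v = 0.\<close>
    ultimately show ?thesis using fv by auto
  qed
  \<comment> \<open>Translation by a adds the c-weight 2 to the b-weight. The weights k, k + 2 and k
    + 4 exhaust the residues mod 3, so one of the translates of g has b-weight opposite to
    j.\<close>
  have "3 dvd j + k \<or> 3 dvd j + (k + 2) \<or> 3 dvd j + (k + 2 + 2)" by presburger
  then consider "3 dvd j + k" | "3 dvd j + (k + 2)" | "3 dvd j + (k + 2 + 2)" by blast
  then show ?thesis
  proof cases
    case 1
    then show ?thesis using orbit_zero[OF g] by blast
  next
    case 2
    then show ?thesis using orbit_zero[of "\<lambda>x. g (a x)" "k + 2"] g_a[OF g] a3 by auto
  next
    case 3
    have "(\<lambda>x. g (a (a x))) \<in> Lin \<and> (\<forall>x. g (a (a (b x))) = \<omega> ^ (k + 2 + 2) * g (a (a x))) \<and>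
        (\<forall>x. g (a (a (c x))) = \<omega> ^ 2 * g (a (a x)))"
      using g_a[of "\<lambda>x. g (a x)" "k + 2"] g_a[OF g] by blast
    with 3 show ?thesis using orbit_zero[of "\<lambda>x. g (a (a x))" "k + 2 + 2"] a3 by auto
  qed
qed

text \<open>Among four factors, each of c-weight s or equal to 1, a c-invariant product contains
  either none or exactly three of the former, so \<open>cubic_sync\<close> supplies all equations
  needed for \<open>bc_sync\<close>. Functions of c-weight t vanish at v, and through their cubes at
  w. The c-weight 0 is left to \<open>exists_orb_Lin_eq\<close>.\<close>

lemma c_weight_sync:
  assumes agr: "agree v w" and st: "{s, t} = {1, 2}"
    and van: "\<And>f j. f \<in> Lin \<Longrightarrow> (\<And>x. f (b x) = \<omega> ^ j * f x) \<Longrightarrow> (\<And>x. f (c x) = \<omega> ^ t * f x) \<Longrightarrow> f v = 0"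
  shows "\<exists>y\<in>orb v. \<forall>f\<in>Lin. \<forall>i j. 0 < j \<longrightarrow> j < 3 \<longrightarrow>
    (\<forall>x. f (b x) = \<omega> ^ i * f x) \<longrightarrow> (\<forall>x. f (c x) = \<omega> ^ j * f x) \<longrightarrow> f y = f w"
proof -
  obtain n where n: "\<And>f. pol Lin 3 f \<Longrightarrow> (\<And>x. f (b x) = f x) \<Longrightarrow> (\<And>x. f (c x) = f x) \<Longrightarrow> f ((a ^^ n) v) = f w"
    using cubic_sync[OF agr] by blast
  define v' where "v' = (a ^^ n) v"
  note n = n[folded v'_def]
  define M where "M = insert (0, 0, \<lambda>_. 1) {(i, s, f) | i f. f \<in> Lin \<and>
    (\<forall>x. f (b x) = \<omega> ^ i * f x) \<and> (\<forall>x. f (c x) = \<omega> ^ s * f x)}"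
  define L where "L i f \<longleftrightarrow> f \<in> Lin \<and> (\<forall>x. f (b x) = \<omega> ^ i * f x) \<and> (\<forall>x. f (c x) = \<omega> ^ s * f x)" for i f
  have cubic: "f1 v' * f2 v' * f3 v' = f1 w * f2 w * f3 w"
    if f: "L i1 f1" "L i2 f2" "L i3 f3" and i: "3 dvd i1 + i2 + i3" for i1 i2 i3 f1 f2 f3
  proof (rule n)
    have "pol Lin (1 + 1 + 1) (\<lambda>x. f1 x * f2 x * f3 x)"
      using f unfolding L_def by (intro pol_mult pol_lin) auto
    then show "pol Lin 3 (\<lambda>x. f1 x * f2 x * f3 x)" by (rule pol_mono) simp
    have "f1 (b x) * f2 (b x) * f3 (b x) = \<omega> ^ (i1 + i2 + i3) * (f1 x * f2 x * f3 x)" for x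
      using f unfolding L_def by (simp add: power_add mult_ac)
    moreover have "\<omega> ^ (i1 + i2 + i3) = 1" using i by (simp only: omega_pow_eq_1_iff)
    ultimately show "f1 (b x) * f2 (b x) * f3 (b x) = f1 x * f2 x * f3 x" for x by simp
    have "f1 (c x) * f2 (c x) * f3 (c x) = \<omega> ^ (s + s + s) * (f1 x * f2 x * f3 x)" for x
      using f unfolding L_def by (simp add: power_add mult_ac)
    moreover have "\<omega> ^ (s + s + s) = 1" by (simp only: omega_pow_eq_1_iff) presburger
    ultimately show "f1 (c x) * f2 (c x) * f3 (c x) = f1 x * f2 x * f3 x" for x by simp
  qed
  have "\<exists>m n. \<forall>(i, j, f)\<in>M. f ((b ^^ m) ((c ^^ n) v')) = f w"
  proof (rule bc_sync)
    fix i1 j1 f1 i2 j2 f2 i3 j3 f3 i4 j4 f4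
    assume m: "(i1, j1, f1) \<in> M" "(i2, j2, f2) \<in> M" "(i3, j3, f3) \<in> M" "(i4, j4, f4) \<in> M"
      and d: "3 dvd i1 + i2 + i3 + i4" "3 dvd j1 + j2 + j3 + j4"
    have st': "s = 1 \<or> s = 2" using st by blast
    have "(i, j, f) = (0, 0, \<lambda>_. 1) \<or> j = s \<and> L i f" if "(i, j, f) \<in> M" for i j f
      using that unfolding M_def L_def by auto
    with m have "(i1, j1, f1) = (0, 0, \<lambda>_. 1) \<or> j1 = s \<and> L i1 f1" "(i2, j2, f2) = (0, 0, \<lambda>_. 1) \<or> j2 = s \<and> L i2 f2"
      "(i3, j3, f3) = (0, 0, \<lambda>_. 1) \<or> j3 = s \<and> L i3 f3" "(i4, j4, f4) = (0, 0, \<lambda>_. 1) \<or> j4 = s \<and> L i4 f4"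
      by blast+
    moreover have "\<not> 3 dvd s" "\<not> 3 dvd s + s" "\<not> 3 dvd s + s + s + s" using st' by presburger+
    ultimately show "f1 v' * f2 v' * f3 v' * f4 v' = f1 w * f2 w * f3 w * f4 w"
      using d cubic[of i1 f1 i2 f2 i3 f3] cubic[of i1 f1 i2 f2 i4 f4]
        cubic[of i1 f1 i3 f3 i4 f4] cubic[of i2 f2 i3 f3 i4 f4]
      by (elim disjE conjE Pair_inject)
        (simp_all only: add_0_left add_0_right mult_1_left mult_1_right simp_thms)
  qed (auto simp: M_def)
  then obtain m l where ml: "\<And>i j f. (i, j, f) \<in> M \<Longrightarrow> f ((b ^^ m) ((c ^^ l) v')) = f w" by blast
  show ?thesis
  proof (intro bexI[of _ "(b ^^ m) ((c ^^ l) v')"] ballI allI impI)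
    show "(b ^^ m) ((c ^^ l) v') \<in> orb v" unfolding v'_def by (intro orb_pow orb_self)
    fix f i j
    assume f: "f \<in> Lin" and j: "0 < j" "j < 3" and fb: "\<forall>x. f (b x) = \<omega> ^ i * f x" and fc: "\<forall>x. f (c x) = \<omega> ^ j * f x"
    have "j = 1 \<or> j = 2" using j by auto
    then have "j = s \<or> j = t" using st by blast
    then show "f ((b ^^ m) ((c ^^ l) v')) = f w"
    proof
      assume "j = s"
      then show ?thesis using f fb fc by (intro ml[of i j]) (auto simp: M_def)
    next
      assume jt: "j = t"
      have fa: "(\<lambda>x. f (a x)) \<in> Lin \<and> (\<forall>x. f (a (b x)) = \<omega> ^ (i + j) * f (a x)) \<and> (\<forall>x. f (a (c x)) = \<omega> ^ j * f (a x))"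
        if "f \<in> Lin" "\<forall>x. f (b x) = \<omega> ^ i * f x" "\<forall>x. f (c x) = \<omega> ^ j * f x" for f i
        using that Lin_a by (simp add: ab ac power_add)
      \<comment> \<open>Translation by a alters only the b-weight, so vanishing of all functions of
        c-weight t passes from v to v'.\<close>
      have "\<exists>i. (\<lambda>x. f ((a ^^ n) x)) \<in> Lin \<and> (\<forall>x. f ((a ^^ n) (b x)) = \<omega> ^ i * f ((a ^^ n) x)) \<and>
          (\<forall>x. f ((a ^^ n) (c x)) = \<omega> ^ j * f ((a ^^ n) x))"
      proof (induction n)
        case 0
        then show ?case using f fb fc by auto
      next
        case (Suc n)
        then show ?case using fa[of "\<lambda>x. f ((a ^^ n) x)"] unfolding funpow_Suc_right comp_def by blast
      qed
      then have fv: "f v' = 0" unfolding v'_def jt using van[of "\<lambda>x. f ((a ^^ n) x)"] by blast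
      have p: "pol Lin 3 (\<lambda>x. f x ^ 3)" using pol_pow[OF pol_lin[OF f], of 3] by simp
      have cube: "(\<omega> ^ k * y) ^ 3 = y ^ 3" for k y
        by (simp add: power_mult_distrib mult.commute[of k] omega_cube flip: power_mult)
           (simp add: power_mult omega_cube)
      have "f v' ^ 3 = f w ^ 3" by (rule n[OF p]) (simp_all add: fb fc cube)
      then have "f w = 0" using fv by simp
      moreover have "f ((b ^^ m) ((c ^^ l) v')) = 0"
        using eigen_funpow[of f b i m] eigen_funpow[of f c j l] fb fc fv by simp
      ultimately show ?thesis by simp
    qed
  qed
qed

text \<open>Meant for a generating triple with b' in the kernel of the character of f and a' outside
  it. Agreement passes to the new triple by \<open>inv\<close>, and the orbit point comes back by
  \<open>orb'\<close>.\<close>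

lemma separate_by_other_generators:
  assumes "heis_action \<omega> a' b' c' Lin"
    and inv: "\<And>f x. (\<And>x. f (a' x) = (f x :: 'k)) \<Longrightarrow> (\<And>x. f (b' x) = f x) \<Longrightarrow> (\<And>x. f (c' x) = f x) \<Longrightarrow>
      f (a x) = f x \<and> f (b x) = f x \<and> f (c x) = f x"
    and orb': "\<And>x. x \<in> orb v \<Longrightarrow> a' x \<in> orb v \<and> b' x \<in> orb v \<and> c' x \<in> orb v"
    and "agree v w" "pol Lin 2 f" "\<And>x. f (a' x) = \<omega> ^ r * f x" "\<not> 3 dvd r" "\<And>x. f (b' x) = f x" "f v \<noteq> 0"
  shows "\<exists>x\<in>orb v. \<forall>f\<in>Lin. f x = f w"
proof -
  interpret H: heis_action \<omega> a' b' c' Lin by (rule assms(1))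
  have "f v = f w" if "pol Lin 9 f" "\<And>x. f (a' x) = f x" "\<And>x. f (b' x) = f x" "\<And>x. f (c' x) = f x" for f
    using agreeD[OF assms(4) that(1)] inv[of f] that by simp
  then have "H.agree v w" unfolding H.agree_def by blast
  from H.separate_by_semiinvariant[OF this assms(5-9)]
  obtain x where x: "x \<in> H.orb v" "\<forall>f\<in>Lin. f x = f w" by blast
  from x(1) have "x \<in> orb v" by (induction rule: H.orb.induct) (auto intro: orb_self dest: orb')
  with x(2) show ?thesis by blast
qed

lemma exists_orb_Lin_eq:
  assumes agr: "agree v w"
  shows "\<exists>x\<in>orb v. \<forall>f\<in>Lin. f x = f w"
proof (cases "\<exists>f r u. pol Lin 2 f \<and> (\<forall>x. f (a x) = \<omega> ^ r * f x) \<and> (\<forall>x. f (b x) = \<omega> ^ u * f x) \<and>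
    \<not> (3 dvd r \<and> 3 dvd u) \<and> f v \<noteq> 0")
  case True
  then obtain f r u where f: "pol Lin 2 f" "\<And>x. f (a x) = \<omega> ^ r * f x" "\<And>x. f (b x) = \<omega> ^ u * f x"
    and ru: "\<not> (3 dvd r \<and> 3 dvd u)" and fv: "f v \<noteq> 0" by blast
  have one: "\<omega> ^ n = 1" if "3 dvd n" for n using that by (simp only: omega_pow_eq_1_iff)
  note norm = a3 b3 c3 ab ac bc
  have Lin_cc: "(\<lambda>x. h (c (c x))) \<in> Lin" and Lin_ab: "(\<lambda>x. h (a (b x))) \<in> Lin"
    and Lin_abb: "(\<lambda>x. h (a (b (b x)))) \<in> Lin" if "h \<in> Lin" for h
    using Lin_c[OF Lin_c[OF that]] Lin_b[OF Lin_a[OF that]] Lin_b[OF Lin_b[OF Lin_a[OF that]]] by auto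
  \<comment> \<open>The character given by (r, u) is trivial on one of b, a, ab, ab^2, which
    represent the four lines of the quotient by c.\<close>
  have r_u: "3 dvd u \<or> 3 dvd r \<or> 3 dvd r + u \<or> 3 dvd r + u + u" by presburger
  from r_u ru consider "3 dvd u" "\<not> 3 dvd r" | "3 dvd r" "\<not> 3 dvd u" | "3 dvd r + u" "\<not> 3 dvd r"
    | "3 dvd r + u + u" "\<not> 3 dvd r"
    by (cases "3 dvd r"; cases "3 dvd u") auto
  then show ?thesis
  proof cases
    case 1
    show ?thesis
      by (rule separate_by_semiinvariant[OF agr f(1,2) 1(2) _ fv]) (simp add: f one 1)
  next
    case 2
    \<comment> \<open>From ab = bac follows ba = abc^2: exchanging a and b inverts c.\<close>
    have "heis_action \<omega> b a (\<lambda>x. c (c x)) Lin"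
      by unfold_locales
        ((simp add: norm; fail) | (intro Lin_add Lin_scale Lin_a Lin_b Lin_ab Lin_abb Lin_cc; assumption))+
    then show ?thesis
    proof (rule separate_by_other_generators[OF _ _ _ agr f(1,3) 2(2) _ fv])
      fix f :: "'v \<Rightarrow> 'k" and x
      assume "\<And>x. f (b x) = f x" "\<And>x. f (a x) = f x" and "\<And>x. f (c (c x)) = f x"
      then show "f (a x) = f x \<and> f (b x) = f x \<and> f (c x) = f x" by (metis c3)
    qed (auto intro: orb.intros simp: f one 2)
  next
    case 3
    have "heis_action \<omega> a (\<lambda>x. a (b x)) c Lin"
      by unfold_locales
        ((simp add: norm; fail) | (intro Lin_add Lin_scale Lin_a Lin_ab Lin_c; assumption))+
    then show ?thesis
    proof (rule separate_by_other_generators[OF _ _ _ agr f(1,2) 3(2) _ fv])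
      fix f :: "'v \<Rightarrow> 'k" and x
      assume "\<And>x. f (a x) = f x" "\<And>x. f (a (b x)) = f x" and "\<And>x. f (c x) = f x"
      then show "f (a x) = f x \<and> f (b x) = f x \<and> f (c x) = f x" by metis
    next
      show "f (a (b x)) = f x" for x using one[OF 3(1)] by (simp add: f power_add)
    qed (auto intro: orb.intros)
  next
    case 4
    \<comment> \<open>The commutator of a and ab^2 is that of a and b^2, namely c^2.\<close>
    have "heis_action \<omega> a (\<lambda>x. a (b (b x))) (\<lambda>x. c (c x)) Lin"
      by unfold_locales
        ((simp add: norm; fail) | (intro Lin_add Lin_scale Lin_a Lin_b Lin_ab Lin_abb Lin_cc; assumption))+
    then show ?thesis
    proof (rule separate_by_other_generators[OF _ _ _ agr f(1,2) 4(2) _ fv])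
      fix f :: "'v \<Rightarrow> 'k" and x
      assume i: "\<And>x. f (a x) = f x" "\<And>x. f (a (b (b x))) = f x" "\<And>x. f (c (c x)) = f x"
      have "f (b x) = f (b (b (b (b x))))" by (simp add: b3)
      also have "\<dots> = f x" using i by metis
      finally show "f (a x) = f x \<and> f (b x) = f x \<and> f (c x) = f x" using i by (metis c3)
    next
      show "f (a (b (b x))) = f x" for x using one[OF 4(1)] by (simp add: f power_add mult.assoc)
    qed (auto intro: orb.intros)
  qed
next
  case False
  then have H: "f v = 0" if "pol Lin 2 f" "\<And>x. f (a x) = \<omega> ^ r * f x" "\<And>x. f (b x) = \<omega> ^ u * f x"
      "\<not> (3 dvd r \<and> 3 dvd u)" for f r u
    using that by blast
  have "\<exists>s t. {s, t} = {1, 2} \<and> (\<forall>f j. f \<in> Lin \<longrightarrow> (\<forall>x. f (b x) = \<omega> ^ j * f x) \<longrightarrow>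
      (\<forall>x. f (c x) = \<omega> ^ t * f x) \<longrightarrow> f v = 0)"
  proof (cases "\<forall>f j. f \<in> Lin \<longrightarrow> (\<forall>x. f (b x) = \<omega> ^ j * f x) \<longrightarrow> (\<forall>x. f (c x) = \<omega> ^ 1 * f x) \<longrightarrow> f v = 0")
    case True
    then show ?thesis by (intro exI[of _ 2] exI[of _ 1]) auto
  next
    case False
    then obtain f j where f: "f \<in> Lin" "\<And>x. f (b x) = \<omega> ^ j * f x" "\<And>x. f (c x) = \<omega> * f x" "f v \<noteq> 0" by auto
    have "g v = 0" if g: "g \<in> Lin" "\<And>x. g (b x) = \<omega> ^ k * g x" "\<And>x. g (c x) = \<omega> ^ 2 * g x" for g k
      by (rule c_weight_1_or_2_vanishes[where f = f and j = j and g = g and k = k and v = v])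
        ((rule H; assumption) | fact f g)+
    then show ?thesis by (intro exI[of _ 1] exI[of _ 2]) blast
  qed
  then obtain s t where st: "{s, t} = {1, 2}" and van: "\<And>f j. f \<in> Lin \<Longrightarrow> (\<And>x. f (b x) = \<omega> ^ j * f x) \<Longrightarrow>
      (\<And>x. f (c x) = \<omega> ^ t * f x) \<Longrightarrow> f v = 0"
    by blast
  have "\<exists>y\<in>orb v. \<forall>f\<in>Lin. \<forall>i j. 0 < j \<longrightarrow> j < 3 \<longrightarrow>
      (\<forall>x. f (b x) = \<omega> ^ i * f x) \<longrightarrow> (\<forall>x. f (c x) = \<omega> ^ j * f x) \<longrightarrow> f y = f w"
    by (rule c_weight_sync[OF agr st]) (rule van; assumption)
  then obtain y where y: "y \<in> orb v" and yw: "\<And>f i j. f \<in> Lin \<Longrightarrow> 0 < j \<Longrightarrow> j < 3 \<Longrightarrow>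
      (\<And>x. f (b x) = \<omega> ^ i * f x) \<Longrightarrow> (\<And>x. f (c x) = \<omega> ^ j * f x) \<Longrightarrow> f y = f w"
    by blast
  \<comment> \<open>Linear functions of c-weight 0 split into semi-invariants of the whole group.
    One with nontrivial character vanishes along the orbit of v by \<open>H\<close>, and at w
    because its cube is invariant; one with trivial character is itself invariant.\<close>
  have y0: "f y = f w" if f: "f \<in> Lin" "\<And>x. f (b x) = \<omega> ^ u * f x" "\<And>x. f (c x) = f x" for f u
  proof -
    have "weight_part a r f y = weight_part a r f w" for r
    proof -
      let ?f = "weight_part a r f"
      have e: "?f (a x) = \<omega> ^ r * ?f x" "?f (b x) = \<omega> ^ u * ?f x" "?f (c x) = ?f x" for x
        using weight_part_eigen[of a r f x] a3 c_invariant_weight_part[of f] f by auto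
      have l: "?f \<in> Lin" using f(1) by (rule Lin_weight_part)
      show ?thesis
      proof (cases "3 dvd r \<and> 3 dvd u")
        case True
        then have "\<omega> ^ r = 1" "\<omega> ^ u = 1" by (simp_all only: omega_pow_eq_1_iff)
        then have i: "?f (a x) = ?f x" "?f (b x) = ?f x" for x using e by simp_all
        have "?f v = ?f w" by (rule agreeD[OF agr pol_lin[OF l]]) (simp_all add: i e(3))
        then show ?thesis using invariant_orb[of ?f y v] i e(3) y by simp
      next
        case False
        have "pol Lin 2 ?f" by (rule pol_mono[OF pol_lin[OF l]]) simp
        then have v0: "?f v = 0" using e(1,2) False by (rule H)
        have cube: "(\<omega> ^ k * z) ^ 3 = z ^ 3" for k z
          by (simp add: power_mult_distrib mult.commute[of k] omega_cube flip: power_mult)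
             (simp add: power_mult omega_cube)
        have "?f v ^ 3 = ?f w ^ 3"
          by (rule agreeD[OF agr pol_pow[OF pol_lin[OF l], of 3]]) (simp_all add: e cube)
        then have "?f w = 0" using v0 by simp
        moreover have "?f y = 0" using e v0 y by (rule eigen_orb_zero)
        ultimately show ?thesis by simp
      qed
    qed
    then show ?thesis using weight_part_sum[of f _ a] by metis
  qed
  have "f y = f w" if "f \<in> Lin" for f
    using that
  proof (rule Lin_agree_from_weights[rotated])
    fix i j and f :: "'v \<Rightarrow> 'k"
    assume f: "f \<in> Lin" "\<And>x. f (b x) = \<omega> ^ i * f x" "\<And>x. f (c x) = \<omega> ^ j * f x" "j < 3"
    show "f y = f w"
    proof (cases "j = 0")
      case True
      then show ?thesis using f by (intro y0[of f i]) auto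
    next
      case False
      then show ?thesis using f by (intro yw[of f j i]) auto
    qed
  qed
  with y show ?thesis by blast
qed

end

section \<open>Evaluation and linear substitution\<close>

abbreviation mon_value :: "(nat \<Rightarrow> 'r::comm_semiring_1) \<Rightarrow> (nat \<Rightarrow>\<^sub>0 nat) \<Rightarrow> 'r" where
  "mon_value s m \<equiv> (\<Prod>i\<in>Poly_Mapping.keys m. s i ^ Poly_Mapping.lookup m i)"

lemma mon_value_superset:
  assumes "finite A" "Poly_Mapping.keys m \<subseteq> A"
  shows "mon_value s m = (\<Prod>i\<in>A. s i ^ Poly_Mapping.lookup m i)"
  using assms by (intro prod.mono_neutral_left) (auto simp: in_keys_iff)

lemma mon_value_add: "mon_value s (m + m') = mon_value s m * mon_value s m'"
proof -
  let ?A = "Poly_Mapping.keys m \<union> Poly_Mapping.keys m'"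
  have "mon_value s (m + m') = (\<Prod>i\<in>?A. s i ^ Poly_Mapping.lookup (m + m') i)"
    by (rule mon_value_superset) (simp_all add: Poly_Mapping.keys_add)
  also have "\<dots> = (\<Prod>i\<in>?A. s i ^ Poly_Mapping.lookup m i) * (\<Prod>i\<in>?A. s i ^ Poly_Mapping.lookup m' i)"
    by (simp add: lookup_add power_add prod.distrib)
  also have "\<dots> = mon_value s m * mon_value s m'"
    by (simp add: mon_value_superset[of ?A])
  finally show ?thesis .
qed

lemma poly_mapping_sum_singles:
  "(\<Sum>m\<in>Poly_Mapping.keys f. Poly_Mapping.single m (Poly_Mapping.lookup f m)) = f"
  by (rule poly_mapping_eqI)
    (auto simp: lookup_sum lookup_single when_def in_keys_iff)

text \<open>Serves to verify identities about evaluation and substitution on constants and variables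
  only.\<close>

lemma mp_induct [consumes 1, case_names const var add mult]:
  fixes f :: "'k::comm_semiring_1 mpoly"
  assumes f: "f \<in> mp_ring n"
    and const: "\<And>c. P (mp_const c)" and var: "\<And>i. i < n \<Longrightarrow> P (mp_var i)"
    and add: "\<And>f g. P f \<Longrightarrow> P g \<Longrightarrow> P (f + g)" and mult: "\<And>f g. P f \<Longrightarrow> P g \<Longrightarrow> P (f * g)"
  shows "P f"
proof -
  have zero: "P 0" using const[of 0] by (simp add: mp_const_def)
  have one: "P 1" using const[of 1] by (simp add: mp_const_def)
  have pow: "P (g ^ k)" if "P g" for g k by (induction k) (auto intro: one mult that)
  have var_pow: "mp_var i ^ k = Poly_Mapping.single (Poly_Mapping.single i k) (1::'k)" for i k
    by (induction k) (simp_all add: mp_var_def mult_single flip: single_add)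
  have prod: "(\<Prod>i\<in>A. Poly_Mapping.single (g i) (1::'k)) = Poly_Mapping.single (\<Sum>i\<in>A. g i) 1"
    for A and g :: "nat \<Rightarrow> nat \<Rightarrow>\<^sub>0 nat"
    by (induction A rule: infinite_finite_induct) (simp_all add: mult_single)
  have single: "Poly_Mapping.single m c = mp_const c * mon_value mp_var m" for m and c :: 'k
    by (simp add: var_pow prod poly_mapping_sum_singles mp_const_def mult_single)
  have P_single: "P (Poly_Mapping.single m c)" if "Poly_Mapping.keys m \<subseteq> {..<n}" for m c
  proof -
    have "P (\<Prod>i\<in>A. mp_var i ^ Poly_Mapping.lookup m i)" if "finite A" "A \<subseteq> {..<n}" for A
      using that by (induction A rule: finite_induct) (auto intro: one mult pow var)
    then show ?thesis unfolding single using that by (intro mult const) auto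
  qed
  have P_sum: "P (\<Sum>m\<in>A. g m)" if "finite A" "\<And>m. m \<in> A \<Longrightarrow> P (g m)" for A and g :: "_ \<Rightarrow> 'k mpoly"
    using that by (induction A rule: finite_induct) (auto intro: zero add)
  have "P (\<Sum>m\<in>Poly_Mapping.keys f. Poly_Mapping.single m (Poly_Mapping.lookup f m))"
    using f by (intro P_sum P_single) (simp_all add: mp_ring_def)
  then show ?thesis by (simp only: poly_mapping_sum_singles)
qed

text \<open>Evaluation (h the identity) and substitution (h = \<open>mp_const\<close>) share one
  proof that insertion is a ring homomorphism.\<close>

locale coeff_hom =
  fixes h :: "'k::comm_semiring_1 \<Rightarrow> 'r::comm_semiring_1"
  assumes h_0: "h 0 = 0" and h_1: "h 1 = 1"
    and h_add: "h (x + y) = h x + h y" and h_mult: "h (x * y) = h x * h y"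
begin

lemma mp_insertion_superset:
  assumes "finite A" "Poly_Mapping.keys f \<subseteq> A"
  shows "mp_insertion h s f = (\<Sum>m\<in>A. h (Poly_Mapping.lookup f m) * mon_value s m)"
  unfolding mp_insertion_def
  using assms by (intro sum.mono_neutral_left) (auto simp: in_keys_iff h_0)

lemma mp_insertion_add: "mp_insertion h s (f + g) = mp_insertion h s f + mp_insertion h s g"
proof -
  let ?A = "Poly_Mapping.keys f \<union> Poly_Mapping.keys g"
  have "mp_insertion h s (f + g) = (\<Sum>m\<in>?A. h (Poly_Mapping.lookup (f + g) m) * mon_value s m)"
    by (rule mp_insertion_superset) (simp_all add: Poly_Mapping.keys_add)
  also have "\<dots> = (\<Sum>m\<in>?A. h (Poly_Mapping.lookup f m) * mon_value s m) +
      (\<Sum>m\<in>?A. h (Poly_Mapping.lookup g m) * mon_value s m)"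
    by (simp add: lookup_add h_add distrib_right sum.distrib)
  also have "\<dots> = mp_insertion h s f + mp_insertion h s g"
    by (simp add: mp_insertion_superset[of ?A])
  finally show ?thesis .
qed

lemma mp_insertion_single: "mp_insertion h s (Poly_Mapping.single m c) = h c * mon_value s m"
  by (subst mp_insertion_superset[of "{m}"]) (simp_all add: lookup_single)

lemma mp_insertion_sum: "mp_insertion h s (\<Sum>i\<in>A. g i) = (\<Sum>i\<in>A. mp_insertion h s (g i))"
  by (induction A rule: infinite_finite_induct)
    (simp_all add: mp_insertion_add, simp_all add: mp_insertion_def)

lemma mp_insertion_mult: "mp_insertion h s (f * g) = mp_insertion h s f * mp_insertion h s g"
proof -
  let ?t = "\<lambda>f m. Poly_Mapping.single m (Poly_Mapping.lookup f m)"
  have "mp_insertion h s (f * g) =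
      mp_insertion h s ((\<Sum>m\<in>Poly_Mapping.keys f. ?t f m) * (\<Sum>m\<in>Poly_Mapping.keys g. ?t g m))"
    by (simp only: poly_mapping_sum_singles)
  also have "\<dots> = (\<Sum>m\<in>Poly_Mapping.keys f. \<Sum>m'\<in>Poly_Mapping.keys g.
      h (Poly_Mapping.lookup f m) * mon_value s m * (h (Poly_Mapping.lookup g m') * mon_value s m'))"
    by (simp add: sum_product mult_single mp_insertion_sum mp_insertion_single h_mult mon_value_add mult_ac)
  also have "\<dots> = mp_insertion h s f * mp_insertion h s g"
    by (simp add: mp_insertion_def sum_product)
  finally show ?thesis .
qed

lemma mp_insertion_const: "mp_insertion h s (mp_const c) = h c"
  by (simp add: mp_const_def mp_insertion_single)

lemma mp_insertion_var: "mp_insertion h s (mp_var i) = s i"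
  by (simp add: mp_var_def mp_insertion_single h_1)

end

lemma mp_const_add: "mp_const (x + y) = mp_const x + mp_const y"
  by (simp add: mp_const_def single_add)

lemma mp_const_mult: "mp_const (x * y) = mp_const x * (mp_const y :: 'k::comm_semiring_1 mpoly)"
  by (simp add: mp_const_def mult_single)

lemma mp_const_0: "mp_const 0 = 0"
  by (simp add: mp_const_def)

lemma mp_const_1: "mp_const 1 = 1"
  by (simp add: mp_const_def)

lemma mp_const_sum: "mp_const (\<Sum>i\<in>A. g i) = (\<Sum>i\<in>A. mp_const (g i :: 'k::comm_semiring_1))"
  by (induction A rule: infinite_finite_induct) (simp_all add: mp_const_0 mp_const_add)

interpretation id_hom: coeff_hom "\<lambda>c :: 'k::comm_semiring_1. c"
  by unfold_locales simp_all

interpretation const_hom: coeff_hom "mp_const :: 'k::comm_semiring_1 \<Rightarrow> 'k mpoly"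
  by unfold_locales (simp_all add: mp_const_0 mp_const_1 mp_const_add mp_const_mult)

section \<open>Linear substitutions on formal polynomials and on points\<close>

definition ev :: "'k::comm_semiring_1 mpoly \<Rightarrow> (nat \<Rightarrow> 'k) \<Rightarrow> 'k" where
  "ev f x = mp_insertion (\<lambda>c. c) x f"

lemma mp_eval_ev: "mp_eval f v = ev f (\<lambda>i. v $ i)"
  by (simp add: mp_eval_def ev_def)

lemma ev_simps:
  "ev (mp_const c) x = c" "ev (mp_var i) x = x i" "ev (f + g) x = ev f x + ev g x"
  "ev (f * g) x = ev f x * ev g x" "ev (\<Sum>i\<in>A. p i) x = (\<Sum>i\<in>A. ev (p i) x)"
  by (simp_all add: ev_def id_hom.mp_insertion_const id_hom.mp_insertion_var id_hom.mp_insertion_add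
      id_hom.mp_insertion_mult id_hom.mp_insertion_sum)

definition lin_subst :: "nat \<Rightarrow> 'k::comm_semiring_1 mat \<Rightarrow> 'k mpoly \<Rightarrow> 'k mpoly" where
  "lin_subst n M = mp_subst (\<lambda>i. \<Sum>j<n. mp_const (M $$ (i, j)) * mp_var j)"

lemma poly_act_eq: "poly_act G n \<rho> g = lin_subst n (\<rho> (inv\<^bsub>G\<^esub> g))"
  by (simp add: fun_eq_iff poly_act_def lin_subst_def)

lemma lin_subst_simps:
  "lin_subst n M (mp_const c) = mp_const c"
  "lin_subst n M (mp_var i) = (\<Sum>j<n. mp_const (M $$ (i, j)) * mp_var j)"
  "lin_subst n M (f + g) = lin_subst n M f + lin_subst n M g"
  "lin_subst n M (f * g) = lin_subst n M f * lin_subst n M g"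
  "lin_subst n M (\<Sum>i\<in>A. p i) = (\<Sum>i\<in>A. lin_subst n M (p i))"
  by (simp_all add: lin_subst_def mp_subst_def const_hom.mp_insertion_const const_hom.mp_insertion_var
      const_hom.mp_insertion_add const_hom.mp_insertion_mult const_hom.mp_insertion_sum)

text \<open>Points are functions on all natural numbers. Fixing the coordinates from n on lets the
  identity matrix act as the identity everywhere, as the unconditional equations of
  \<open>heis_action\<close> demand.\<close>

definition mat_act :: "nat \<Rightarrow> 'k::comm_semiring_1 mat \<Rightarrow> (nat \<Rightarrow> 'k) \<Rightarrow> nat \<Rightarrow> 'k" where
  "mat_act n M x = (\<lambda>i. if i < n then \<Sum>j<n. M $$ (i, j) * x j else x i)"

lemma ev_lin_subst: "f \<in> mp_ring n \<Longrightarrow> ev (lin_subst n M f) x = ev f (mat_act n M x)"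
  by (induction f rule: mp_induct) (simp_all add: ev_simps lin_subst_simps mat_act_def)

lemma ev_cong: "f \<in> mp_ring n \<Longrightarrow> (\<And>i. i < n \<Longrightarrow> x i = y i) \<Longrightarrow> ev f x = ev f y"
  by (induction f rule: mp_induct) (simp_all add: ev_simps)

lemma mat_mult_entry:
  assumes "A \<in> carrier_mat n n" "B \<in> carrier_mat n n" "i < n" "k < n"
  shows "(A * B) $$ (i, k) = (\<Sum>j<n. A $$ (i, j) * B $$ (j, k))"
  using assms by (simp add: scalar_prod_def atLeast0LessThan)

text \<open>Substitution is a pullback and reverses the order of the matrices; the inverse in
  \<open>poly_act\<close> turns this into a left action.\<close>

lemma lin_subst_mult:
  assumes "A \<in> carrier_mat n n" "B \<in> carrier_mat n n" "f \<in> mp_ring n"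
  shows "lin_subst n B (lin_subst n A f) = lin_subst n (A * B) f"
  using assms(3)
proof (induction f rule: mp_induct)
  case (var i)
  have "lin_subst n B (lin_subst n A (mp_var i)) =
      (\<Sum>j<n. \<Sum>k<n. mp_const (A $$ (i, j) * B $$ (j, k)) * mp_var k)"
    by (simp add: lin_subst_simps sum_distrib_left mp_const_mult mult.assoc)
  also have "\<dots> = (\<Sum>k<n. mp_const (\<Sum>j<n. A $$ (i, j) * B $$ (j, k)) * mp_var k)"
    by (subst sum.swap) (simp add: mp_const_sum sum_distrib_right)
  also have "\<dots> = (\<Sum>k<n. mp_const ((A * B) $$ (i, k)) * mp_var k)"
    by (rule sum.cong) (use var assms in \<open>simp_all add: mat_mult_entry del: index_mult_mat\<close>)
  also have "\<dots> = lin_subst n (A * B) (mp_var i)"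
    by (simp only: lin_subst_simps)
  finally show ?case .
qed (simp_all add: lin_subst_simps)

lemma lin_subst_one: "f \<in> mp_ring n \<Longrightarrow> lin_subst n (1\<^sub>m n) f = f"
proof (induction f rule: mp_induct)
  case (var i)
  have "lin_subst n (1\<^sub>m n) (mp_var i) = (\<Sum>j<n. if j = i then mp_var i else (0 :: 'a mpoly))"
    unfolding lin_subst_simps using var by (intro sum.cong) (auto simp: mp_const_0 mp_const_1)
  also have "\<dots> = mp_var i" using var by simp
  finally show ?case .
qed (simp_all add: lin_subst_simps)

lemma mat_act_mult:
  assumes "A \<in> carrier_mat n n" "B \<in> carrier_mat n n"
  shows "mat_act n A (mat_act n B x) = mat_act n (A * B) x"
proof
  fix i
  show "mat_act n A (mat_act n B x) i = mat_act n (A * B) x i"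
  proof (cases "i < n")
    case True
    have "mat_act n A (mat_act n B x) i = (\<Sum>j<n. \<Sum>k<n. A $$ (i, j) * B $$ (j, k) * x k)"
      using True by (simp add: mat_act_def sum_distrib_left mult.assoc)
    also have "\<dots> = (\<Sum>k<n. (\<Sum>j<n. A $$ (i, j) * B $$ (j, k)) * x k)"
      by (subst sum.swap) (simp add: sum_distrib_right)
    also have "\<dots> = (\<Sum>k<n. (A * B) $$ (i, k) * x k)"
      by (rule sum.cong) (use True assms in \<open>simp_all add: mat_mult_entry del: index_mult_mat\<close>)
    also have "\<dots> = mat_act n (A * B) x i"
      using True by (simp only: mat_act_def if_True)
    finally show ?thesis .
  qed (simp add: mat_act_def)
qed

lemma mat_act_one: "mat_act n (1\<^sub>m n) x = x"
proof
  fix i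
  show "mat_act n (1\<^sub>m n) x i = x i"
  proof (cases "i < n")
    case True
    then have "mat_act n (1\<^sub>m n) x i = (\<Sum>j<n. 1\<^sub>m n $$ (i, j) * x j)"
      by (simp add: mat_act_def)
    also have "\<dots> = (\<Sum>j<n. if j = i then x i else 0)"
      by (rule sum.cong) (use True in auto)
    finally show ?thesis using True by simp
  qed (simp add: mat_act_def)
qed

lemma mat_act_vec:
  assumes "M \<in> carrier_mat n n" "v \<in> carrier_vec n" "i < n"
  shows "mat_act n M (\<lambda>i. v $ i) i = (M *\<^sub>v v) $ i"
  using assms by (simp add: mat_act_def scalar_prod_def atLeast0LessThan)

section \<open>Degree bounds and averaging\<close>

definition mp_deg_le :: "nat \<Rightarrow> nat \<Rightarrow> 'k::zero mpoly set" where
  "mp_deg_le n d = {f \<in> mp_ring n. mp_total_degree f \<le> d}"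

lemma mp_deg_le_iff:
  "f \<in> mp_deg_le n d \<longleftrightarrow> (\<forall>m\<in>Poly_Mapping.keys f. Poly_Mapping.keys m \<subseteq> {..<n} \<and>
     (\<Sum>i\<in>Poly_Mapping.keys m. Poly_Mapping.lookup m i) \<le> d)"
  by (auto simp: mp_deg_le_def mp_ring_def mp_total_degree_def)

lemma mp_deg_le_ring: "f \<in> mp_deg_le n d \<Longrightarrow> f \<in> mp_ring n"
  by (simp add: mp_deg_le_def)

lemma mp_deg_le_mono: "f \<in> mp_deg_le n d \<Longrightarrow> d \<le> e \<Longrightarrow> f \<in> mp_deg_le n e"
  by (simp add: mp_deg_le_def)

lemma mp_deg_le_const: "mp_const c \<in> mp_deg_le n d"
  by (auto simp: mp_deg_le_iff mp_const_def)

lemma mp_deg_le_var: "i < n \<Longrightarrow> mp_var i \<in> mp_deg_le n 1"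
  by (auto simp: mp_deg_le_iff mp_var_def)

lemma mp_deg_le_add: "f \<in> mp_deg_le n d \<Longrightarrow> g \<in> mp_deg_le n d \<Longrightarrow> f + g \<in> mp_deg_le n d"
  unfolding mp_deg_le_iff using Poly_Mapping.keys_add[of f g] by blast

lemma mp_deg_le_sum: "(\<And>i. i \<in> A \<Longrightarrow> g i \<in> mp_deg_le n d) \<Longrightarrow> (\<Sum>i\<in>A. g i) \<in> mp_deg_le n d"
  by (induction A rule: infinite_finite_induct)
    (auto intro: mp_deg_le_add, auto simp: mp_deg_le_iff)

lemma mp_deg_le_mult:
  assumes f: "f \<in> mp_deg_le n d" and g: "g \<in> mp_deg_le n e"
  shows "f * (g :: 'k::comm_semiring_1 mpoly) \<in> mp_deg_le n (d + e)"
  unfolding mp_deg_le_iff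
proof
  have deg: "(\<Sum>i\<in>Poly_Mapping.keys m. Poly_Mapping.lookup m i) = (\<Sum>i\<in>A. Poly_Mapping.lookup m i)"
    if "finite A" "Poly_Mapping.keys m \<subseteq> A" for A and m :: "nat \<Rightarrow>\<^sub>0 nat"
    using that by (intro sum.mono_neutral_left) (auto simp: in_keys_iff)
  fix m assume "m \<in> Poly_Mapping.keys (f * g)"
  then obtain p q where pq: "p \<in> Poly_Mapping.keys f" "q \<in> Poly_Mapping.keys g" "m = p + q"
    using keys_mult[of f g] by blast
  have k: "Poly_Mapping.keys p \<subseteq> {..<n}" "Poly_Mapping.keys q \<subseteq> {..<n}"
    using f g pq unfolding mp_deg_le_iff by auto
  then have km: "Poly_Mapping.keys m \<subseteq> {..<n}"
    using Poly_Mapping.keys_add[of p q] pq by blast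
  have "(\<Sum>i<n. Poly_Mapping.lookup p i) \<le> d" "(\<Sum>i<n. Poly_Mapping.lookup q i) \<le> e"
    using f g pq k unfolding mp_deg_le_iff by (metis deg finite_lessThan)+
  then have "(\<Sum>i<n. Poly_Mapping.lookup m i) \<le> d + e"
    by (simp add: pq lookup_add sum.distrib)
  then show "Poly_Mapping.keys m \<subseteq> {..<n} \<and> (\<Sum>i\<in>Poly_Mapping.keys m. Poly_Mapping.lookup m i) \<le> d + e"
    using km by (simp add: deg[of "{..<n}"])
qed

lemma mp_deg_le_lin_subst:
  assumes "f \<in> mp_deg_le n d"
  shows "lin_subst n M f \<in> mp_deg_le n (d :: nat)"
proof -
  have lin: "(\<Sum>j<n. mp_const (M $$ (i, j)) * mp_var j) \<in> mp_deg_le n 1" for i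
    by (intro mp_deg_le_sum)
      (metis add_0 lessThan_iff mp_deg_le_const mp_deg_le_mult mp_deg_le_var)
  have pow: "g ^ k \<in> mp_deg_le n k" if "g \<in> mp_deg_le n 1" for g :: "'a mpoly" and k
  proof (induction k)
    case 0
    show ?case using mp_deg_le_const[of "1::'a" n 0] by (simp add: mp_const_1)
  next
    case (Suc k)
    show ?case using mp_deg_le_mult[OF that Suc] by simp
  qed
  have prod: "(\<Prod>i\<in>A. g i ^ e i) \<in> mp_deg_le n (\<Sum>i\<in>A. e i)"
    if "\<And>i. g i \<in> mp_deg_le n 1" for A :: "nat set" and g :: "nat \<Rightarrow> 'a mpoly" and e
  proof (induction A rule: infinite_finite_induct)
    case (insert i A)
    then show ?case using mp_deg_le_mult[OF pow[OF that]] by simp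
  qed (use mp_deg_le_const[of "1::'a" n 0] in \<open>simp_all add: mp_const_1\<close>)
  show ?thesis
    unfolding lin_subst_def mp_subst_def mp_insertion_def
  proof (rule mp_deg_le_sum)
    fix m assume m: "m \<in> Poly_Mapping.keys f"
    have "mp_const (Poly_Mapping.lookup f m) * mon_value (\<lambda>i. \<Sum>j<n. mp_const (M $$ (i, j)) * mp_var j) m
        \<in> mp_deg_le n (0 + (\<Sum>i\<in>Poly_Mapping.keys m. Poly_Mapping.lookup m i))"
      by (intro mp_deg_le_mult mp_deg_le_const prod lin)
    then show "mp_const (Poly_Mapping.lookup f m) * mon_value (\<lambda>i. \<Sum>j<n. mp_const (M $$ (i, j)) * mp_var j) m
        \<in> mp_deg_le n d"
      by (rule mp_deg_le_mono) (use assms m in \<open>auto simp: mp_deg_le_iff\<close>)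
  qed
qed

text \<open>The Reynolds operator of the cyclic group generated by a matrix of order three. If the
  values of f are invariant already, it keeps them and makes the formal polynomial
  invariant.\<close>

definition reynolds3 :: "nat \<Rightarrow> 'k::field mat \<Rightarrow> 'k mpoly \<Rightarrow> 'k mpoly" where
  "reynolds3 n M f = mp_const (1 / 3) * (f + lin_subst n M f + lin_subst n M (lin_subst n M f))"

lemma mp_deg_le_reynolds3: "(f :: 'k::field mpoly) \<in> mp_deg_le n d \<Longrightarrow> reynolds3 n M f \<in> mp_deg_le n d"
  unfolding reynolds3_def
  using mp_deg_le_mult[OF mp_deg_le_const[of "1 / 3 :: 'k" n 0], of
      "f + lin_subst n M f + lin_subst n M (lin_subst n M f)" d]
  by (simp add: mp_deg_le_add mp_deg_le_lin_subst)

lemma lin_subst_reynolds3: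
  assumes "f \<in> mp_ring n" "M \<in> carrier_mat n n" "M * (M * M) = 1\<^sub>m n"
  shows "lin_subst n M (reynolds3 n M f) = reynolds3 n M f"
proof -
  have "lin_subst n M (lin_subst n M (lin_subst n M f)) = f"
    using assms by (simp add: lin_subst_mult lin_subst_one)
  then show ?thesis by (simp add: reynolds3_def lin_subst_simps add_ac)
qed

lemma ev_reynolds3:
  assumes "f \<in> mp_deg_le n d" "(3 :: 'k::field) \<noteq> 0" "\<And>x. ev f (mat_act n M x) = (ev f x :: 'k)"
  shows "ev (reynolds3 n M f) x = ev f x"
proof -
  have r: "f \<in> mp_ring n" "lin_subst n M f \<in> mp_ring n"
    using mp_deg_le_ring[OF assms(1)] mp_deg_le_ring[OF mp_deg_le_lin_subst[OF assms(1)]] by auto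
  have "ev (reynolds3 n M f) x = (1 / 3) * (ev f x + ev f x + ev f x)"
    by (simp add: reynolds3_def ev_simps ev_lin_subst r assms(3))
  also have "\<dots> = (1 / 3) * (3 * ev f x)" by simp
  finally show ?thesis using assms(2) by simp
qed

section \<open>Representations of the presented group\<close>

abbreviation heis_class :: "heis_gen word \<Rightarrow> heis_gen word set" where
  "heis_class \<equiv> pres_class heis_rels"

lemma H27_carrier: "carrier H27 = range heis_class"
  by (simp add: H27_def presented_group_def)

lemma heis_class_carrier: "heis_class u \<in> carrier H27"
  by (simp add: H27_carrier)

lemma H27_one: "\<one>\<^bsub>H27\<^esub> = heis_class []"
  by (simp add: H27_def presented_group_def)

lemma H27_mult: "heis_class u \<otimes>\<^bsub>H27\<^esub> heis_class v = heis_class (u @ v)"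
  by (simp add: H27_def presented_group_mult)

lemma H27_group: "group H27"
  by (simp add: H27_def group_presented_group)

lemma heis_class_rel: "(u, v) \<in> heis_rels \<Longrightarrow> heis_class u = heis_class v"
  by (simp add: pres_class_eq_iff pc_rel)

lemma heis_class_cancel: "heis_class [(x, e), (x, \<not> e)] = heis_class []"
  by (simp add: pres_class_eq_iff pc_cancel)

definition gen :: "heis_gen \<Rightarrow> heis_gen word set" where
  "gen x = heis_class [(x, True)]"

lemma gen_carrier: "gen x \<in> carrier H27"
  by (simp add: gen_def heis_class_carrier)

lemma gen_cube: "gen x \<otimes>\<^bsub>H27\<^esub> (gen x \<otimes>\<^bsub>H27\<^esub> gen x) = \<one>\<^bsub>H27\<^esub>"
  unfolding gen_def H27_mult H27_one
  by (rule heis_class_rel) (cases x, auto simp: heis_rels_def Let_def)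

lemma gen_inverse: "heis_class [(x, False)] = gen x \<otimes>\<^bsub>H27\<^esub> gen x"
proof -
  interpret group H27 by (rule H27_group)
  have "gen x \<otimes>\<^bsub>H27\<^esub> heis_class [(x, False)] = gen x \<otimes>\<^bsub>H27\<^esub> (gen x \<otimes>\<^bsub>H27\<^esub> gen x)"
    unfolding gen_cube using heis_class_cancel[of x True] by (simp add: gen_def H27_mult H27_one)
  then show ?thesis by (simp add: gen_carrier heis_class_carrier)
qed

lemma gen_comm:
  "gen GA \<otimes>\<^bsub>H27\<^esub> gen GC = gen GC \<otimes>\<^bsub>H27\<^esub> gen GA"
  "gen GB \<otimes>\<^bsub>H27\<^esub> gen GC = gen GC \<otimes>\<^bsub>H27\<^esub> gen GB"
  unfolding gen_def H27_mult by (rule heis_class_rel, simp add: heis_rels_def Let_def)+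

lemma gen_ab: "gen GA \<otimes>\<^bsub>H27\<^esub> gen GB = gen GB \<otimes>\<^bsub>H27\<^esub> (gen GA \<otimes>\<^bsub>H27\<^esub> gen GC)"
proof -
  let ?a' = "heis_class [(GA, False)]" and ?b' = "heis_class [(GB, False)]"
  interpret group H27 by (rule H27_group)
  have "heis_class [(GA, False), (GB, False), (GA, True), (GB, True)] = heis_class [(GC, True)]"
    by (rule heis_class_rel) (simp add: heis_rels_def Let_def)
  then have C: "gen GC = ?a' \<otimes>\<^bsub>H27\<^esub> (?b' \<otimes>\<^bsub>H27\<^esub> (gen GA \<otimes>\<^bsub>H27\<^esub> gen GB))"
    by (simp add: gen_def H27_mult)
  have i: "?a' = inv\<^bsub>H27\<^esub> (gen GA)" "?b' = inv\<^bsub>H27\<^esub> (gen GB)"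
    by (rule inv_equality[symmetric];
        use heis_class_cancel[of GA False] heis_class_cancel[of GB False] in
          \<open>simp add: gen_def H27_mult H27_one heis_class_carrier\<close>)+
  show ?thesis unfolding C i
    by (simp add: gen_carrier m_assoc[symmetric])
qed

lemma H27_rep_gens:
  assumes "is_rep H27 n \<rho>"
  shows "\<rho> (gen x) \<in> carrier_mat n n"
    "\<rho> (gen x) * (\<rho> (gen x) * \<rho> (gen x)) = 1\<^sub>m n"
    "\<rho> (gen GA) * \<rho> (gen GC) = \<rho> (gen GC) * \<rho> (gen GA)"
    "\<rho> (gen GB) * \<rho> (gen GC) = \<rho> (gen GC) * \<rho> (gen GB)"
    "\<rho> (gen GA) * \<rho> (gen GB) = \<rho> (gen GB) * (\<rho> (gen GA) * \<rho> (gen GC))"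
proof -
  interpret group H27 by (rule H27_group)
  have m: "\<rho> (g \<otimes>\<^bsub>H27\<^esub> h) = \<rho> g * \<rho> h" if "g \<in> carrier H27" "h \<in> carrier H27" for g h
    using assms that by (simp add: is_rep_def)
  show "\<rho> (gen x) \<in> carrier_mat n n" using assms by (simp add: is_rep_def gen_carrier)
  show "\<rho> (gen x) * (\<rho> (gen x) * \<rho> (gen x)) = 1\<^sub>m n"
    using assms gen_cube[of x] by (simp add: is_rep_def gen_carrier flip: m)
  show "\<rho> (gen GA) * \<rho> (gen GC) = \<rho> (gen GC) * \<rho> (gen GA)"
    "\<rho> (gen GB) * \<rho> (gen GC) = \<rho> (gen GC) * \<rho> (gen GB)"
    "\<rho> (gen GA) * \<rho> (gen GB) = \<rho> (gen GB) * (\<rho> (gen GA) * \<rho> (gen GC))"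
    by (simp_all add: gen_carrier gen_comm gen_ab flip: m)
qed

text \<open>An inverse letter is the square of its generator, so every group element acts by a
  product of generator matrices.\<close>

lemma H27_rep_induct [consumes 2, case_names one gen]:
  assumes rep: "is_rep H27 n \<rho>" and g: "g \<in> carrier H27"
    and one: "P (1\<^sub>m n)"
    and step: "\<And>x M. M \<in> carrier_mat n n \<Longrightarrow> P M \<Longrightarrow> P (\<rho> (gen x) * M)"
  shows "P (\<rho> g)"
proof -
  obtain u where u: "g = heis_class u" using g by (auto simp: H27_carrier)
  have m: "\<rho> (g \<otimes>\<^bsub>H27\<^esub> h) = \<rho> g * \<rho> h" if "g \<in> carrier H27" "h \<in> carrier H27" for g h
    using rep that by (simp add: is_rep_def)
  have car: "\<rho> (heis_class u) \<in> carrier_mat n n" for u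
    using rep by (simp add: is_rep_def H27_carrier)
  have "P (\<rho> (heis_class u))"
  proof (induction u)
    case Nil
    show ?case using rep one by (simp add: is_rep_def H27_one)
  next
    case (Cons l u)
    obtain x e where l: "l = (x, e)" by (cases l)
    have s: "\<rho> (heis_class (l # u)) = \<rho> (heis_class [l]) * \<rho> (heis_class u)"
      using m[of "heis_class [l]" "heis_class u"] by (simp add: H27_mult H27_carrier)
    show ?case
    proof (cases e)
      case True
      then show ?thesis using step[OF car Cons, of x] s l by (simp add: gen_def)
    next
      case False
      have "\<rho> (heis_class [l]) = \<rho> (gen x) * \<rho> (gen x)"
        using False by (simp add: l gen_inverse m gen_carrier)
      then have "\<rho> (heis_class (l # u)) = \<rho> (gen x) * (\<rho> (gen x) * \<rho> (heis_class u))"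
        unfolding s using H27_rep_gens(1)[OF rep, of x] car[of u] by simp
      then show ?thesis using H27_rep_gens(1)[OF rep, of x] car[of u] by (simp add: step Cons)
    qed
  qed
  then show ?thesis by (simp add: u)
qed

text \<open>Von Dyck's argument: matrices are multiplied along a word, each rule of
  \<open>pres_cong\<close> preserves the product, and a class is evaluated at a chosen word. Inverse
  letters go to squares.\<close>

lemma H27_rep_exists:
  fixes A :: "heis_gen \<Rightarrow> 'k::field mat"
  assumes car: "\<And>x. A x \<in> carrier_mat n n"
    and cube: "\<And>x. A x * (A x * A x) = 1\<^sub>m n"
    and ac: "A GA * A GC = A GC * A GA" and bc: "A GB * A GC = A GC * A GB"
    and ab: "A GA * A GB = A GB * (A GA * A GC)"
  shows "\<exists>\<rho>. is_rep H27 n \<rho> \<and> (\<forall>x. \<rho> (gen x) = A x)"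
proof -
  define L where "L = (\<lambda>(x, e). if e then A x else A x * A x)"
  define W where "W = foldr (\<lambda>l M. L l * M)"
  have Lc: "L l \<in> carrier_mat n n" for l
    using car mult_carrier_mat[OF car car] by (cases l) (simp add: L_def)
  define wm where "wm u = W u (1\<^sub>m n)" for u
  have wm_simps: "wm [] = 1\<^sub>m n" "wm (l # u) = L l * wm u" for l u
    by (simp_all add: wm_def W_def)
  have wmc: "wm u \<in> carrier_mat n n" for u
    by (induction u) (simp_all add: wm_simps Lc mult_carrier_mat[OF Lc])
  have app: "wm (u @ v) = wm u * wm v" for u v
    by (induction u) (simp_all add: wm_simps assoc_mult_mat[OF Lc wmc wmc] left_mult_one_mat[OF wmc])
  note cc = car mult_carrier_mat[OF car car] mult_carrier_mat[OF car]
  have assoc: "(A x * A y) * M = A x * (A y * M)" if "M \<in> carrier_mat n n" for x y M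
    using assoc_mult_mat[OF car car that] .
  have cubeM: "A x * (A x * (A x * M)) = M" if "M \<in> carrier_mat n n" for x M
  proof -
    have "A x * (A x * (A x * M)) = (A x * (A x * A x)) * M"
      using car[of x] that by (simp add: assoc_mult_mat[of _ n n _ n _ n])
    then show ?thesis using that by (simp add: cube)
  qed
  have "wm u = wm v" if "pres_cong heis_rels u v" for u v
    using that
  proof (induction rule: pres_cong.induct)
    case (pc_cancel x e)
    show ?case
      by (cases e) (simp_all add: wm_simps L_def right_mult_one_mat[OF cc(2)] right_mult_one_mat[OF car]
          assoc cc cube)
  next
    case (pc_rel u v)
    \<comment> \<open>The commutator relation, with both inverses written as squares.\<close>
    have "A GA * (A GA * (A GB * (A GB * (A GA * A GB)))) = A GC"
      unfolding ab by (simp add: cubeM cc)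
    then show ?case
      using pc_rel
      by (auto simp: heis_rels_def Let_def wm_simps L_def right_mult_one_mat[OF cc(2)]
          right_mult_one_mat[OF car] assoc cc cube ac bc)
  qed (simp_all add: app)
  note wm_cong = this
  define \<rho> where "\<rho> X = wm (SOME u. X = heis_class u)" for X
  have \<rho>: "\<rho> (heis_class u) = wm u" for u
    unfolding \<rho>_def by (rule someI2[of _ u]) (auto simp: pres_class_eq_iff dest: wm_cong)
  have "is_rep H27 n \<rho>"
    by (auto simp: is_rep_def H27_carrier \<rho> wmc H27_one wm_simps H27_mult app)
  moreover have "\<rho> (gen x) = A x" for x
    by (simp add: gen_def \<rho> wm_simps L_def right_mult_one_mat[OF car])
  ultimately show ?thesis by blast
qed

lemma ev_invariant:
  assumes rep: "is_rep H27 n \<rho>" and f: "f \<in> invariants H27 n \<rho>" and g: "g \<in> carrier H27"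
  shows "ev f (mat_act n (\<rho> g) x) = ev f x"
proof -
  interpret group H27 by (rule H27_group)
  have "poly_act H27 n \<rho> (inv\<^bsub>H27\<^esub> g) f = f"
    using f g by (simp add: invariants_def)
  then have "lin_subst n (\<rho> g) f = f" using g by (simp add: poly_act_eq)
  moreover have "f \<in> mp_ring n" using f by (simp add: invariants_def)
  ultimately show ?thesis by (metis ev_lin_subst)
qed

lemma invariants_of_gens:
  assumes rep: "is_rep H27 n \<rho>" and f: "f \<in> mp_ring n"
    and gens: "\<And>x. lin_subst n (\<rho> (gen x)) f = f"
  shows "f \<in> invariants H27 n \<rho>"
proof -
  interpret group H27 by (rule H27_group)
  have "lin_subst n (\<rho> g) f = f" if "g \<in> carrier H27" for g
    using rep that
  proof (induction rule: H27_rep_induct)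
    case one
    show ?case using f by (rule lin_subst_one)
  next
    case (gen x M)
    then show ?case
      using lin_subst_mult[OF H27_rep_gens(1)[OF rep] gen(1) f, of x] by (simp add: gens)
  qed
  then show ?thesis using f by (simp add: invariants_def poly_act_eq)
qed

section \<open>Degree nine is necessary\<close>

context cube_root
begin

text \<open>Shift and clock matrices of the Schroedinger representation with central character
  \<open>\<omega>\<close>.\<close>

definition heis_mat :: "heis_gen \<Rightarrow> 'k mat" where
  "heis_mat x = mat 3 3 (case x of
      GA \<Rightarrow> (\<lambda>(i, j). if j = (i + 1) mod 3 then 1 else 0)
    | GB \<Rightarrow> (\<lambda>(i, j). if j = i then \<omega> ^ i else 0)
    | GC \<Rightarrow> (\<lambda>(i, j). if j = i then \<omega> else 0))"

definition vec3 :: "'k \<Rightarrow> 'k \<Rightarrow> 'k \<Rightarrow> nat \<Rightarrow> 'k" where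
  "vec3 p q r = (\<lambda>i. if i = 0 then p else if i = 1 then q else if i = 2 then r else 0)"

lemma lessThan_3: "{..<3} = {0, 1, 2 :: nat}"
  by auto

lemma less_3_cases: "i < 3 \<Longrightarrow> i = 0 \<or> i = 1 \<or> i = (2 :: nat)"
  by auto

lemma heis_mat_carrier: "heis_mat x \<in> carrier_mat 3 3"
  by (simp add: heis_mat_def)

lemma mat_act_heis_mat:
  "mat_act 3 (heis_mat GA) (vec3 p q r) = vec3 q r p"
  "mat_act 3 (heis_mat GB) (vec3 p q r) = vec3 p (\<omega> * q) (\<omega> ^ 2 * r)"
  "mat_act 3 (heis_mat GC) (vec3 p q r) = vec3 (\<omega> * p) (\<omega> * q) (\<omega> * r)"
  by (auto simp: fun_eq_iff mat_act_def heis_mat_def vec3_def lessThan_3 dest!: less_3_cases)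

lemma mat_eq_3I:
  assumes "A \<in> carrier_mat 3 3" "B \<in> carrier_mat 3 3"
    and "\<And>p q r. mat_act 3 A (vec3 p q r) = mat_act 3 B (vec3 p q r)"
  shows "A = B"
proof (rule eq_matI)
  fix i j assume "i < dim_row B" "j < dim_col B"
  then have ij: "i < 3" "j < 3" using assms by auto
  have "mat_act 3 A (vec3 p q r) i = mat_act 3 B (vec3 p q r) i" for p q r
    using assms(3) by simp
  from this[of 1 0 0] this[of 0 1 0] this[of 0 0 1] less_3_cases[OF ij(2)]
  show "A $$ (i, j) = B $$ (i, j)"
    using ij by (auto simp: mat_act_def lessThan_3 vec3_def)
qed (use assms in auto)

lemma heis_mat_rep: "\<exists>\<rho>. is_rep H27 3 \<rho> \<and> (\<forall>x. \<rho> (gen x) = heis_mat x)"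
proof (rule H27_rep_exists)
  note car = heis_mat_carrier mult_carrier_mat[OF heis_mat_carrier] one_carrier_mat
  have w1: "\<omega> * (\<omega> * (\<omega> * y)) = y" for y
    using omega_cube by (simp add: power3_eq_cube flip: mult.assoc)
  have w3: "\<omega> ^ 2 * (\<omega> ^ 2 * (\<omega> ^ 2 * y)) = y" "\<omega> * (\<omega> ^ 2 * y) = y" "\<omega> ^ 2 * (\<omega> * y) = y" for y
    by (simp_all add: power2_eq_square mult.assoc w1)
  have w111: "\<omega> * (\<omega> * \<omega>) = 1"
    using w1[of 1] by simp
  have w6: "\<omega> ^ 6 = 1" by (simp add: omega_pow_eq_1_iff)
  show "heis_mat x * (heis_mat x * heis_mat x) = 1\<^sub>m 3" for x
    by (cases x; rule mat_eq_3I)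
      (simp_all add: car mat_act_one mat_act_heis_mat w1 w3 w6 flip: mat_act_mult)
  show "heis_mat GA * heis_mat GC = heis_mat GC * heis_mat GA"
    "heis_mat GB * heis_mat GC = heis_mat GC * heis_mat GB"
    "heis_mat GA * heis_mat GB = heis_mat GB * (heis_mat GA * heis_mat GC)"
    by (rule mat_eq_3I; simp add: car mat_act_heis_mat power2_eq_square w111 mult_ac flip: mat_act_mult)+
qed (rule heis_mat_carrier)

text \<open>Averaging the three twists multiplies the term of m by 1 or 0. Applied to the values of
  an invariant, it discards the monomials not fixed by a diagonal matrix without any comparison of
  coefficients.\<close>

lemma root_of_unity_filter:
  assumes "finite A" and "\<And>k. k < 3 \<Longrightarrow> (\<Sum>m\<in>A. c m * \<omega> ^ (k * s m)) = E"
  shows "E = (\<Sum>m | m \<in> A \<and> 3 dvd s m. c m)"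
proof -
  have filt: "1 + \<omega> ^ n + \<omega> ^ (2 * n) = (if 3 dvd n then 3 else 0)" for n
  proof -
    have n: "n mod 3 = 0 \<or> n mod 3 = 1 \<or> n mod 3 = 2" by presburger
    have "\<omega> ^ n = \<omega> ^ (n mod 3)" "\<omega> ^ (2 * n) = \<omega> ^ (2 * (n mod 3))"
      by (simp_all add: omega_pow_eq_iff mod_mult_right_eq)
    moreover have "\<omega> ^ 4 = \<omega>" using omega_pow_mod[of 4] by simp
    ultimately show ?thesis using n omega_sum
      by (elim disjE) (auto simp: dvd_eq_mod_eq_0 add_ac power2_eq_square)
  qed
  have "3 * E = (\<Sum>m\<in>A. c m * \<omega> ^ (0 * s m)) + (\<Sum>m\<in>A. c m * \<omega> ^ (1 * s m)) + (\<Sum>m\<in>A. c m * \<omega> ^ (2 * s m))"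
    using assms(2)[of 0] assms(2)[of 1] assms(2)[of 2] by simp
  also have "\<dots> = (\<Sum>m\<in>A. c m * (1 + \<omega> ^ s m + \<omega> ^ (2 * s m)))"
    by (simp add: sum.distrib distrib_left)
  also have "\<dots> = (\<Sum>m\<in>A. if 3 dvd s m then 3 * c m else 0)"
    by (rule sum.cong) (simp_all add: filt)
  also have "\<dots> = (\<Sum>m | m \<in> A \<and> 3 dvd s m. 3 * c m)"
    using assms(1) by (simp add: sum.inter_filter)
  also have "\<dots> = 3 * (\<Sum>m | m \<in> A \<and> 3 dvd s m. c m)"
    by (simp add: sum_distrib_left)
  finally show ?thesis using three_neq_0 by simp
qed

text \<open>The divisibility conditions say that the monomial is invariant under \<open>b\<close> and \<open>c\<close>. Up to degree
  eight it is divisible by \<open>x y z\<close> or has a symmetric cyclic sum; this fails for \<open>x\<^sup>6 y\<^sup>3\<close>.\<close>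

lemma cyclic_sum_symmetric:
  fixes t :: 'k
  assumes "3 dvd i + j + k" "3 dvd j + 2 * k" "i + j + k \<le> (8 :: nat)"
  shows "0 ^ i * 1 ^ j * t ^ k + 1 ^ i * t ^ j * 0 ^ k + t ^ i * 0 ^ j * 1 ^ k =
    1 ^ i * 0 ^ j * t ^ k + 0 ^ i * t ^ j * 1 ^ k + t ^ i * 1 ^ j * 0 ^ k"
proof (cases "i = 0 \<or> j = 0 \<or> k = 0")
  case True
  \<comment> \<open>Once one exponent is zero, the congruences make all of them multiples of three.
    In terms of cubes the degree is at most two, and a cyclic sum in three variables is then
    symmetric; x^2 y is the first exception, whence degree nine.\<close>
  then have "3 dvd i" "3 dvd j" "3 dvd k" using assms by presburger+
  then obtain i' j' k' where "i = 3 * i'" "j = 3 * j'" "k = 3 * k'" by (auto elim!: dvdE)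
  moreover from this have "i' + j' + k' \<le> 2" using assms(3) by simp
  then have "i' \<le> 2" "j' \<le> 2" "k' \<le> 2" "i' + j' + k' \<le> 2" by auto
  moreover from this have "i' = 0 \<or> i' = 1 \<or> i' = 2" "j' = 0 \<or> j' = 1 \<or> j' = 2" "k' = 0 \<or> k' = 1 \<or> k' = 2"
    by auto
  ultimately show ?thesis by (elim disjE) simp_all
qed (simp add: power_0_left)

text \<open>The two points differ by a transposition of coordinates. Filtering by c and b and
  summing over the cyclic shift leaves cyclic sums of monomials, whose values do not notice this
  transposition.\<close>

lemma low_degree_invariants_agree:
  assumes rep: "is_rep H27 3 \<rho>" and gens: "\<And>x. \<rho> (gen x) = heis_mat x"
    and f: "f \<in> invariants H27 3 \<rho>" "f \<in> mp_deg_le 3 8"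
  shows "ev f (vec3 0 1 t) = ev f (vec3 1 0 t)"
proof -
  let ?K = "Poly_Mapping.keys f"
  define l where "l = (Poly_Mapping.lookup :: (nat \<Rightarrow>\<^sub>0 nat) \<Rightarrow> nat \<Rightarrow> nat)"
  define T where "T p q r m = Poly_Mapping.lookup f m * (p ^ l m 0 * q ^ l m 1 * r ^ l m 2)" for p q r m
  have K: "Poly_Mapping.keys m \<subseteq> {0, 1, 2}" "l m 0 + l m 1 + l m 2 \<le> 8" if "m \<in> ?K" for m
  proof -
    show k: "Poly_Mapping.keys m \<subseteq> {0, 1, 2}"
      using f(2) that unfolding mp_deg_le_iff lessThan_3 by blast
    have "(\<Sum>i\<in>Poly_Mapping.keys m. l m i) = (\<Sum>i\<in>{0, 1, 2}. l m i)"
      using k by (intro sum.mono_neutral_left) (auto simp: in_keys_iff l_def)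
    moreover have "(\<Sum>i\<in>Poly_Mapping.keys m. l m i) \<le> 8"
      using f(2) that unfolding mp_deg_le_iff l_def by blast
    ultimately show "l m 0 + l m 1 + l m 2 \<le> 8" by simp
  qed
  have E: "ev f (vec3 p q r) = (\<Sum>m\<in>?K. T p q r m)" for p q r
    unfolding ev_def mp_insertion_def T_def
  proof (rule sum.cong)
    fix m assume "m \<in> ?K"
    then show "Poly_Mapping.lookup f m * mon_value (vec3 p q r) m =
        Poly_Mapping.lookup f m * (p ^ l m 0 * q ^ l m 1 * r ^ l m 2)"
      using mon_value_superset[of "{0, 1, 2}" m "vec3 p q r"] K(1)[of m] by (simp add: vec3_def l_def mult_ac)
  qed simp
  have inv: "ev f (mat_act 3 (heis_mat x) y) = ev f y" for x y
    using ev_invariant[OF rep f(1) gen_carrier, of x y] by (simp add: gens)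
  have c: "ev f (vec3 (\<omega> ^ k * p) (\<omega> ^ k * q) (\<omega> ^ k * r)) = ev f (vec3 p q r)" for k p q r
  proof (induction k)
    case (Suc k)
    then show ?case
      using inv[of GC "vec3 (\<omega> ^ k * p) (\<omega> ^ k * q) (\<omega> ^ k * r)"] by (simp add: mat_act_heis_mat mult.assoc)
  qed simp
  have b: "ev f (vec3 p (\<omega> ^ k * q) (\<omega> ^ (2 * k) * r)) = ev f (vec3 p q r)" for k p q r
  proof (induction k)
    case (Suc k)
    then show ?case
      using inv[of GB "vec3 p (\<omega> ^ k * q) (\<omega> ^ (2 * k) * r)"]
      by (simp add: mat_act_heis_mat mult.assoc power_add power2_eq_square)
  qed simp
  have 1: "ev f (vec3 p q r) = (\<Sum>m | m \<in> ?K \<and> 3 dvd l m 0 + l m 1 + l m 2. T p q r m)" for p q r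
  proof (rule root_of_unity_filter)
    fix k :: nat
    show "(\<Sum>m\<in>?K. T p q r m * \<omega> ^ (k * (l m 0 + l m 1 + l m 2))) = ev f (vec3 p q r)"
      unfolding c[of k p q r, symmetric] unfolding E
      by (rule sum.cong) (simp_all add: T_def power_mult_distrib power_mult power_add mult_ac)
  qed simp
  let ?M = "{m \<in> {m \<in> ?K. 3 dvd l m 0 + l m 1 + l m 2}. 3 dvd l m 1 + 2 * l m 2}"
  have 2: "ev f (vec3 p q r) = (\<Sum>m\<in>?M. T p q r m)" for p q r
  proof (rule root_of_unity_filter)
    fix k :: nat
    show "(\<Sum>m\<in>{m \<in> ?K. 3 dvd l m 0 + l m 1 + l m 2}. T p q r m * \<omega> ^ (k * (l m 1 + 2 * l m 2))) = ev f (vec3 p q r)"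
      unfolding b[of p k q r, symmetric] unfolding 1
      by (rule sum.cong) (simp_all add: T_def power_mult_distrib power_add distrib_left mult_ac flip: power_mult)
  qed simp
  have a: "ev f (vec3 q r p) = ev f (vec3 p q r)" for p q r
    using inv[of GA "vec3 p q r"] by (simp add: mat_act_heis_mat)
  have 3: "3 * ev f (vec3 p q r) = (\<Sum>m\<in>?M. T p q r m + T q r p m + T r p q m)" for p q r
    using a[of q r p] a[of r p q] 2[of p q r] 2[of q r p] 2[of r p q] by (simp add: sum.distrib)
  have "3 * ev f (vec3 0 1 t) = 3 * ev f (vec3 1 0 t)"
    unfolding 3
  proof (rule sum.cong)
    fix m assume m: "m \<in> ?M"
    have "T 0 1 t m + T 1 t 0 m + T t 0 1 m = Poly_Mapping.lookup f m *
        (0 ^ l m 0 * 1 ^ l m 1 * t ^ l m 2 + 1 ^ l m 0 * t ^ l m 1 * 0 ^ l m 2 + t ^ l m 0 * 0 ^ l m 1 * 1 ^ l m 2)"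
      by (simp add: T_def distrib_left)
    also have "\<dots> = Poly_Mapping.lookup f m *
        (1 ^ l m 0 * 0 ^ l m 1 * t ^ l m 2 + 0 ^ l m 0 * t ^ l m 1 * 1 ^ l m 2 + t ^ l m 0 * 1 ^ l m 1 * 0 ^ l m 2)"
      using m K(2)[of m] by (subst cyclic_sum_symmetric) auto
    finally show "T 0 1 t m + T 1 t 0 m + T t 0 1 m = T 1 0 t m + T 0 t 1 m + T t 1 0 m"
      by (simp add: T_def distrib_left)
  qed simp
  then show ?thesis using three_neq_0 by simp
qed

lemma degree_below_9_not_separating:
  fixes t :: 'k
  assumes t: "t \<noteq> 0" "t ^ 3 \<noteq> 1"
  shows "\<exists>\<rho> :: _ \<Rightarrow> 'k mat. is_rep H27 3 \<rho> \<and>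
    (\<forall>d<9. \<not> separating_set H27 3 \<rho> {f \<in> invariants H27 3 \<rho>. mp_total_degree f \<le> d})"
proof -
  obtain \<rho> where rep: "is_rep H27 3 \<rho>" and gens: "\<And>x. \<rho> (gen x) = heis_mat x"
    using heis_mat_rep by blast
  define v where "v p q r = vec 3 (vec3 p q r)" for p q r
  have vc: "v p q r \<in> carrier_vec 3" for p q r by (simp add: v_def)
  \<comment> \<open>Only the values of F matter: it is constant on orbits, and equals t^3 and t^6 at
    the two points.\<close>
  define F where "F x = x 0 ^ 6 * x 1 ^ 3 + x 1 ^ 6 * x 2 ^ 3 + x 2 ^ 6 * x (0::nat) ^ 3" for x :: "nat \<Rightarrow> 'k"
  have pw: "\<omega> ^ 6 = 1" "\<omega> ^ 12 = 1" by (simp_all add: omega_pow_eq_1_iff)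
  have Fg: "F (mat_act 3 (heis_mat y) x) = F x" for x y
  proof -
    have "mat_act 3 (heis_mat y) x i = mat_act 3 (heis_mat y) (vec3 (x 0) (x 1) (x 2)) i" if "i < 3" for i
      using that by (simp add: mat_act_def lessThan_3 vec3_def)
    then have "F (mat_act 3 (heis_mat y) x) = F (mat_act 3 (heis_mat y) (vec3 (x 0) (x 1) (x 2)))"
      by (simp add: F_def)
    also have "\<dots> = F x"
      by (cases y; simp only: mat_act_heis_mat)
        (simp_all add: F_def vec3_def power_mult_distrib omega_cube pw add_ac flip: power_mult)
    finally show ?thesis .
  qed
  have Frep: "F (mat_act 3 (\<rho> g) x) = F x" if "g \<in> carrier H27" for g x
    using rep that
  proof (induction rule: H27_rep_induct)
    case one
    show ?case by (simp add: mat_act_one)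
  next
    case (gen y M)
    then show ?case using mat_act_mult[OF heis_mat_carrier gen(1), of y x] Fg[of y "mat_act 3 M x"] by (simp add: gens)
  qed
  have orb: "rep_orbit H27 \<rho> (v 0 1 t) \<noteq> rep_orbit H27 \<rho> (v 1 0 t)"
  proof
    assume eq: "rep_orbit H27 \<rho> (v 0 1 t) = rep_orbit H27 \<rho> (v 1 0 t)"
    have "\<rho> \<one>\<^bsub>H27\<^esub> *\<^sub>v v 1 0 t = v 1 0 t" using rep vc by (simp add: is_rep_def)
    then have "v 1 0 t \<in> rep_orbit H27 \<rho> (v 1 0 t)"
      unfolding rep_orbit_def using heis_class_carrier[of "[]"]
      by (intro CollectI exI[of _ "\<one>\<^bsub>H27\<^esub>"]) (simp add: H27_one)
    then obtain g where g: "g \<in> carrier H27" "v 1 0 t = \<rho> g *\<^sub>v v 0 1 t"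
      unfolding eq[symmetric] unfolding rep_orbit_def by auto
    have gc: "\<rho> g \<in> carrier_mat 3 3" using rep g by (simp add: is_rep_def)
    have "mat_act 3 (\<rho> g) (\<lambda>i. v 0 1 t $ i) i = v 1 0 t $ i" if "i < 3" for i
      unfolding g(2) using gc vc that by (rule mat_act_vec)
    then have "F (\<lambda>i. v 1 0 t $ i) = F (mat_act 3 (\<rho> g) (\<lambda>i. v 0 1 t $ i))"
      by (simp add: F_def)
    also have "\<dots> = F (\<lambda>i. v 0 1 t $ i)" by (rule Frep[OF g(1)])
    finally have "t ^ 6 = t ^ 3" by (simp add: F_def v_def vec3_def)
    then have "t ^ 3 * (t ^ 3 - 1) = 0" by (simp add: algebra_simps flip: power_add)
    then show False using t by simp
  qed
  have agree: "mp_eval f (v 0 1 t) = mp_eval f (v 1 0 t)"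
    if "f \<in> invariants H27 3 \<rho>" "mp_total_degree f \<le> d" "d < 9" for f d
  proof -
    have r: "f \<in> mp_ring 3" using that by (simp add: invariants_def)
    have "mp_eval f (v p q r) = ev f (vec3 p q r)" for p q r
      unfolding mp_eval_ev using r by (rule ev_cong) (simp add: v_def)
    moreover have "f \<in> mp_deg_le 3 8" using that r by (simp add: mp_deg_le_def)
    ultimately show ?thesis using low_degree_invariants_agree[OF rep gens that(1)] by simp
  qed
  show ?thesis
    using rep orb agree vc unfolding separating_set_def by blast
qed

end

section \<open>Degree nine suffices\<close>

definition linear_forms :: "nat \<Rightarrow> ((nat \<Rightarrow> 'k::field) \<Rightarrow> 'k) set" where
  "linear_forms n = range (\<lambda>k x. \<Sum>i<n. k i * x i)"

lemma linear_formsI: "(\<lambda>x. \<Sum>i<n. k i * x i) \<in> linear_forms n"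
  by (simp add: linear_forms_def)

lemma linear_forms_add: "f \<in> linear_forms n \<Longrightarrow> g \<in> linear_forms n \<Longrightarrow> (\<lambda>x. f x + g x) \<in> linear_forms n"
proof -
  assume "f \<in> linear_forms n" "g \<in> linear_forms n"
  then obtain k l where "f = (\<lambda>x. \<Sum>i<n. k i * x i)" "g = (\<lambda>x. \<Sum>i<n. l i * x i)"
    by (auto simp: linear_forms_def)
  then have "(\<lambda>x. f x + g x) = (\<lambda>x. \<Sum>i<n. (k i + l i) * x i)"
    by (simp add: distrib_right sum.distrib)
  then show ?thesis by (simp only: linear_formsI)
qed

lemma linear_forms_scale: "f \<in> linear_forms n \<Longrightarrow> (\<lambda>x. c * f x) \<in> linear_forms n"
proof -
  assume "f \<in> linear_forms n"
  then obtain k where "f = (\<lambda>x. \<Sum>i<n. k i * x i)" by (auto simp: linear_forms_def)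
  then have "(\<lambda>x. c * f x) = (\<lambda>x. \<Sum>i<n. (c * k i) * x i)"
    by (simp add: sum_distrib_left mult.assoc)
  then show ?thesis by (simp only: linear_formsI)
qed

lemma linear_forms_mat_act: "f \<in> linear_forms n \<Longrightarrow> (\<lambda>x. f (mat_act n M x)) \<in> linear_forms n"
proof -
  assume "f \<in> linear_forms n"
  then obtain k where k: "f = (\<lambda>x. \<Sum>i<n. k i * x i)" by (auto simp: linear_forms_def)
  have "f (mat_act n M x) = (\<Sum>j<n. (\<Sum>i<n. k i * M $$ (i, j)) * x j)" for x
  proof -
    have "f (mat_act n M x) = (\<Sum>i<n. \<Sum>j<n. k i * M $$ (i, j) * x j)"
      by (simp add: k mat_act_def sum_distrib_left mult.assoc)
    also have "\<dots> = (\<Sum>j<n. (\<Sum>i<n. k i * M $$ (i, j)) * x j)"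
      by (subst sum.swap) (simp add: sum_distrib_right)
    finally show ?thesis .
  qed
  then show ?thesis by (simp only: linear_formsI)
qed

lemma coordinate_linear_form: "i < n \<Longrightarrow> (\<lambda>x. x i :: 'k::field) \<in> linear_forms n"
proof -
  assume "i < n"
  then have "(\<Sum>j<n. (if j = i then 1 else 0) * x j) = x i" for x :: "nat \<Rightarrow> 'k"
    by (subst sum.remove[of _ i]) auto
  then have "(\<lambda>x :: nat \<Rightarrow> 'k. x i) = (\<lambda>x. \<Sum>j<n. (if j = i then 1 else 0) * x j)" by auto
  then show ?thesis by (simp only: linear_formsI)
qed

text \<open>The way back from functions to formal polynomials. Over a finite field the result need
  not be formally invariant even if F is; \<open>invariant_of_function\<close> repairs this.\<close>

lemma pol_linear_forms_formal:
  assumes "pol (linear_forms n) d F"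
  shows "\<exists>f\<in>mp_deg_le n d. \<forall>x. ev f x = F x"
  using assms
proof (induction rule: pol.induct)
  case (pol_const d k)
  show ?case by (rule bexI[OF _ mp_deg_le_const[of k]]) (simp add: ev_simps)
next
  case (pol_lin f)
  then obtain k where k: "f = (\<lambda>x. \<Sum>i<n. k i * x i)" by (auto simp: linear_forms_def)
  have "(\<Sum>i<n. mp_const (k i) * mp_var i) \<in> mp_deg_le n 1"
    using mp_deg_le_mult[OF mp_deg_le_const[of _ n 0] mp_deg_le_var[of _ n]]
    by (intro mp_deg_le_sum) simp
  then show ?case by (rule bexI[rotated]) (simp add: ev_simps k)
next
  case (pol_mono d f e)
  then show ?case using mp_deg_le_mono by blast
next
  case (pol_add d f g)
  then obtain p q where "p \<in> mp_deg_le n d" "\<forall>x. ev p x = f x" "q \<in> mp_deg_le n d" "\<forall>x. ev q x = g x"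
    by blast
  then show ?case by (intro bexI[of _ "p + q"] mp_deg_le_add) (simp_all add: ev_simps)
next
  case (pol_mult d f e g)
  then obtain p q where "p \<in> mp_deg_le n d" "\<forall>x. ev p x = f x" "q \<in> mp_deg_le n e" "\<forall>x. ev q x = g x"
    by blast
  then show ?case by (intro bexI[of _ "p * q"] mp_deg_le_mult) (simp_all add: ev_simps)
qed

lemma lin_subst_reynolds3_other:
  assumes "lin_subst n B f = f" "lin_subst n B (lin_subst n A f) = lin_subst n A f"
    "lin_subst n B (lin_subst n A (lin_subst n A f)) = lin_subst n A (lin_subst n A f)"
  shows "lin_subst n B (reynolds3 n A f) = reynolds3 n A f"
  by (simp add: reynolds3_def lin_subst_simps assms)

text \<open>Averages over c, then b, then a. In this order each average keeps the invariance gained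
  before, because c is central and generates with b a normal subgroup. Values are unchanged, being
  invariant from the start.\<close>

lemma invariant_of_function:
  fixes \<rho> :: "_ \<Rightarrow> 'k::field mat"
  assumes rep: "is_rep H27 n \<rho>" and three: "(3 :: 'k) \<noteq> 0" and f: "f \<in> mp_deg_le n d"
    and inv: "\<And>y x. ev f (mat_act n (\<rho> (gen y)) x) = ev f x"
  shows "\<exists>g\<in>invariants H27 n \<rho>. mp_total_degree g \<le> d \<and> (\<forall>x. ev g x = ev f x)"
proof -
  let ?A = "\<rho> (gen GA)" and ?B = "\<rho> (gen GB)" and ?C = "\<rho> (gen GC)"
  note car = H27_rep_gens(1)[OF rep] and cube = H27_rep_gens(2)[OF rep]
  note rel = H27_rep_gens(3-5)[OF rep]
  note mult_car = mult_carrier_mat[OF car car]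
  define g1 where "g1 = reynolds3 n ?C f"
  define g2 where "g2 = reynolds3 n ?B g1"
  define g3 where "g3 = reynolds3 n ?A g2"
  have m: "g1 \<in> mp_deg_le n d" "g2 \<in> mp_deg_le n d" "g3 \<in> mp_deg_le n d"
    by (simp_all add: g1_def g2_def g3_def f mp_deg_le_reynolds3)
  note r = m[THEN mp_deg_le_ring] mp_deg_le_lin_subst[THEN mp_deg_le_ring]
  have commC: "lin_subst n ?C (lin_subst n (\<rho> (gen x)) h) = lin_subst n (\<rho> (gen x)) h"
    if "h \<in> mp_deg_le n d" "lin_subst n ?C h = h" "x = GA \<or> x = GB" for h x
  proof -
    have "lin_subst n ?C (lin_subst n (\<rho> (gen x)) h) = lin_subst n (\<rho> (gen x)) (lin_subst n ?C h)"
      using that(3) by (auto simp: lin_subst_mult[OF car car] mp_deg_le_ring[OF that(1)] rel)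
    then show ?thesis by (simp add: that(2))
  qed
  have invB: "lin_subst n ?B (lin_subst n ?A h) = lin_subst n ?A h"
    if h: "h \<in> mp_deg_le n d" "lin_subst n ?C h = h" "lin_subst n ?B h = h" for h
  proof -
    have "lin_subst n ?B (lin_subst n ?A h) = lin_subst n (?B * (?A * ?C)) h"
      by (simp add: lin_subst_mult[OF car car] mp_deg_le_ring[OF h(1)] rel)
    also have "\<dots> = lin_subst n (?A * ?C) (lin_subst n ?B h)"
      by (rule lin_subst_mult[OF car mult_car mp_deg_le_ring[OF h(1)], symmetric])
    also have "\<dots> = lin_subst n ?C (lin_subst n ?A h)"
      by (simp add: h(3) lin_subst_mult[OF car car] mp_deg_le_ring[OF h(1)])
    also have "\<dots> = lin_subst n ?A h" using commC[OF h(1,2)] by simp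
    finally show ?thesis .
  qed
  have C1: "lin_subst n ?C g1 = g1"
    unfolding g1_def by (rule lin_subst_reynolds3[OF mp_deg_le_ring[OF f] car cube])
  have C2: "lin_subst n ?C g2 = g2"
    unfolding g2_def by (intro lin_subst_reynolds3_other commC C1 m mp_deg_le_lin_subst) simp_all
  have B2: "lin_subst n ?B g2 = g2"
    unfolding g2_def by (rule lin_subst_reynolds3[OF r(1) car cube])
  have C3: "lin_subst n ?C g3 = g3"
    unfolding g3_def by (intro lin_subst_reynolds3_other commC C2 m mp_deg_le_lin_subst) simp_all
  have B3: "lin_subst n ?B g3 = g3"
    unfolding g3_def by (intro lin_subst_reynolds3_other commC invB C2 B2 m mp_deg_le_lin_subst) simp_all
  have A3: "lin_subst n ?A g3 = g3"
    unfolding g3_def by (rule lin_subst_reynolds3[OF r(2) car cube])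
  have "lin_subst n (\<rho> (gen x)) g3 = g3" for x
    using A3 B3 C3 by (cases x) auto
  then have "g3 \<in> invariants H27 n \<rho>" by (rule invariants_of_gens[OF rep r(3)])
  moreover have "mp_total_degree g3 \<le> d" using m(3) by (simp add: mp_deg_le_def)
  moreover have e1: "ev g1 x = ev f x" for x
    unfolding g1_def by (rule ev_reynolds3[OF f three inv])
  have e2: "ev g2 x = ev f x" for x
    unfolding g2_def e1[symmetric] by (rule ev_reynolds3[OF m(1) three]) (simp add: e1 inv)
  have "ev g3 x = ev f x" for x
    unfolding g3_def e2[symmetric] by (rule ev_reynolds3[OF m(2) three]) (simp add: e2 inv)
  ultimately show ?thesis by blast
qed

lemma rep_orbit_translate:
  assumes G: "group G" and rep: "is_rep G n \<rho>" and g: "g \<in> carrier G" and v: "v \<in> carrier_vec n"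
  shows "rep_orbit G \<rho> (\<rho> g *\<^sub>v v) = rep_orbit G \<rho> v"
proof -
  interpret group G by (rule G)
  have m: "\<rho> h *\<^sub>v (\<rho> k *\<^sub>v v) = \<rho> (h \<otimes>\<^bsub>G\<^esub> k) *\<^sub>v v" if "h \<in> carrier G" "k \<in> carrier G" for h k
    using rep that v assoc_mult_mat_vec[of "\<rho> h" n n "\<rho> k" n v] by (simp add: is_rep_def)
  have s: "\<rho> h *\<^sub>v v = \<rho> (h \<otimes>\<^bsub>G\<^esub> inv\<^bsub>G\<^esub> g) *\<^sub>v (\<rho> g *\<^sub>v v)" if "h \<in> carrier G" for h
    using that g by (simp add: m m_assoc)
  show ?thesis
  proof (intro equalityI subsetI)
    fix y assume "y \<in> rep_orbit G \<rho> (\<rho> g *\<^sub>v v)"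
    then obtain h where "h \<in> carrier G" "y = \<rho> (h \<otimes>\<^bsub>G\<^esub> g) *\<^sub>v v"
      unfolding rep_orbit_def using g m by auto
    then show "y \<in> rep_orbit G \<rho> v" unfolding rep_orbit_def using g by blast
  next
    fix y assume "y \<in> rep_orbit G \<rho> v"
    then obtain h where "h \<in> carrier G" "y = \<rho> (h \<otimes>\<^bsub>G\<^esub> inv\<^bsub>G\<^esub> g) *\<^sub>v (\<rho> g *\<^sub>v v)"
      unfolding rep_orbit_def using s by auto
    then show "y \<in> rep_orbit G \<rho> (\<rho> g *\<^sub>v v)" unfolding rep_orbit_def using g by blast
  qed
qed

text \<open>Coordinates are linear forms, so the orbit point supplied by
  \<open>exists_orb_Lin_eq\<close> coincides with w in all n coordinates.\<close>

lemma (in cube_root) degree_9_separating: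
  fixes \<rho> :: "_ \<Rightarrow> 'k mat"
  assumes rep: "is_rep H27 n \<rho>"
  shows "separating_set H27 n \<rho> {f \<in> invariants H27 n \<rho>. mp_total_degree f \<le> 9}"
proof -
  interpret G: group H27 by (rule H27_group)
  let ?act = "\<lambda>x. mat_act n (\<rho> (gen x))"
  note car = H27_rep_gens(1)[OF rep]
  note mult_car = mult_carrier_mat[OF car car]
  interpret heis_action \<omega> "?act GA" "?act GB" "?act GC" "linear_forms n"
  proof
    show "?act GA (?act GA (?act GA x)) = x" "?act GB (?act GB (?act GB x)) = x"
      "?act GC (?act GC (?act GC x)) = x" for x
      by (simp_all add: mat_act_mult[OF car car] mat_act_mult[OF car mult_car] H27_rep_gens(2)[OF rep] mat_act_one)
    show "?act GA (?act GB x) = ?act GB (?act GA (?act GC x))"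
      "?act GA (?act GC x) = ?act GC (?act GA x)" "?act GB (?act GC x) = ?act GC (?act GB x)" for x
      by (simp_all add: mat_act_mult[OF car car] mat_act_mult[OF car mult_car] H27_rep_gens(3-5)[OF rep])
  qed (simp_all add: linear_forms_add linear_forms_scale linear_forms_mat_act)
  have "rep_orbit H27 \<rho> v = rep_orbit H27 \<rho> w"
    if v: "v \<in> carrier_vec n" and w: "w \<in> carrier_vec n"
      and eq: "\<And>f. f \<in> invariants H27 n \<rho> \<Longrightarrow> mp_total_degree f \<le> 9 \<Longrightarrow> mp_eval f v = mp_eval f w" for v w
  proof -
    have "agree (\<lambda>i. v $ i) (\<lambda>i. w $ i)"
      unfolding agree_def
    proof (intro allI impI)
      fix F assume F: "pol (linear_forms n) 9 F" and i: "\<forall>x. F (?act GA x) = F x" "\<forall>x. F (?act GB x) = F x"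
        "\<forall>x. F (?act GC x) = F x"
      obtain f where f: "f \<in> mp_deg_le n 9" "\<And>x. ev f x = F x"
        using pol_linear_forms_formal[OF F] by blast
      have "ev f (?act y x) = ev f x" for y x
        using i by (cases y) (simp_all add: f(2))
      from invariant_of_function[OF rep three_neq_0 f(1) this]
      obtain g where g: "g \<in> invariants H27 n \<rho>" "mp_total_degree g \<le> 9" "\<And>x. ev g x = F x"
        by (auto simp: f(2))
      show "F (\<lambda>i. v $ i) = F (\<lambda>i. w $ i)"
        using eq[OF g(1,2)] by (simp add: mp_eval_ev g(3))
    qed
    then obtain z where z: "z \<in> orb (\<lambda>i. v $ i)" and zw: "\<forall>f\<in>linear_forms n. f z = f (\<lambda>i. w $ i)"
      using exists_orb_Lin_eq by blast
    have step: "\<exists>h\<in>carrier H27. ?act y (mat_act n (\<rho> g) u) = mat_act n (\<rho> h) u" if "g \<in> carrier H27" for y g u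
    proof (rule bexI[of _ "gen y \<otimes>\<^bsub>H27\<^esub> g"])
      have "\<rho> g \<in> carrier_mat n n" "\<rho> (gen y \<otimes>\<^bsub>H27\<^esub> g) = \<rho> (gen y) * \<rho> g"
        using rep that gen_carrier by (simp_all add: is_rep_def)
      then show "?act y (mat_act n (\<rho> g) u) = mat_act n (\<rho> (gen y \<otimes>\<^bsub>H27\<^esub> g)) u"
        by (simp add: mat_act_mult[OF car])
    qed (simp add: that gen_carrier)
    have "\<exists>g\<in>carrier H27. z = mat_act n (\<rho> g) (\<lambda>i. v $ i)"
      using z
    proof (induction rule: orb.induct)
      case orb_self
      have "\<rho> \<one>\<^bsub>H27\<^esub> = 1\<^sub>m n" using rep by (simp add: is_rep_def)
      then show ?case by (intro bexI[of _ "\<one>\<^bsub>H27\<^esub>"]) (simp_all add: mat_act_one)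
    qed (use step in blast)+
    then obtain g where g: "g \<in> carrier H27" "z = mat_act n (\<rho> g) (\<lambda>i. v $ i)" by blast
    have gc: "\<rho> g \<in> carrier_mat n n" using rep g by (simp add: is_rep_def)
    have "w = \<rho> g *\<^sub>v v"
    proof (rule eq_vecI)
      fix i assume "i < dim_vec (\<rho> g *\<^sub>v v)"
      then have i: "i < n" using gc by simp
      have "w $ i = z i" using zw coordinate_linear_form[OF i] by fastforce
      then show "w $ i = (\<rho> g *\<^sub>v v) $ i" unfolding g(2) using mat_act_vec[OF gc v i] by simp
    qed (use gc w in auto)
    then show ?thesis using rep_orbit_translate[OF H27_group rep g(1) v] by simp
  qed
  then show ?thesis unfolding separating_set_def by blast
qed

theorem theorem3p10:
  assumes "\<exists>z :: 'k::field. z ^ 3 = 1 \<and> (\<forall>m::nat. 0 < m \<and> m < 3 \<longrightarrow> z ^ m \<noteq> 1)"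
    and "card (UNIV :: 'k set) \<noteq> 4"
  shows "beta_sep TYPE('k) H27 = 9"
proof -
  obtain \<omega> :: 'k where w: "\<omega> ^ 3 = 1" "\<And>m::nat. 0 < m \<Longrightarrow> m < 3 \<Longrightarrow> \<omega> ^ m \<noteq> 1" using assms(1) by blast
  interpret cube_root \<omega>
    using w(1) w(2)[of 1] by unfold_locales simp_all
  have "card {0, 1, \<omega>, \<omega> ^ 2} = 4"
  proof -
    have "\<omega> ^ 2 \<noteq> \<omega>" using omega_neq_1 omega_neq_0 by (simp add: power2_eq_square)
    then show ?thesis using omega_neq_0 omega_neq_1 omega_sq_neq_1 by (auto simp: card_insert_if)
  qed
  \<comment> \<open>If these four elements were all of K, its cardinality would be 4. Infinite K is
    included, since \<open>card\<close> is then 0.\<close>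
  then obtain t where t: "t \<notin> {0, 1, \<omega>, \<omega> ^ 2}" using assms(2) by (metis UNIV_eq_I)
  have "t ^ 3 \<noteq> 1"
  proof
    assume "t ^ 3 = 1"
    then obtain k where k: "k < 3" "t = \<omega> ^ k" using cube_root_of_unity by blast
    then have "k = 0 \<or> k = 1 \<or> k = 2" by auto
    then show False using t k by auto
  qed
  then obtain \<rho> :: "_ \<Rightarrow> 'k mat" where rep: "is_rep H27 3 \<rho>"
    and low: "\<And>d. d < 9 \<Longrightarrow> \<not> separating_set H27 3 \<rho> {f \<in> invariants H27 3 \<rho>. mp_total_degree f \<le> d}"
    using degree_below_9_not_separating[of t] t by blast
  have up: "beta_sep_module H27 n \<sigma> \<le> 9" if "is_rep H27 n \<sigma>" for n and \<sigma> :: "_ \<Rightarrow> 'k mat"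
    unfolding beta_sep_module_def by (rule Least_le) (simp add: degree_9_separating[OF that])
  have "9 \<le> beta_sep_module H27 3 \<rho>"
  proof -
    have "0 < beta_sep_module H27 3 \<rho> \<and> separating_set H27 3 \<rho>
        {f \<in> invariants H27 3 \<rho>. mp_total_degree f \<le> beta_sep_module H27 3 \<rho>}"
      unfolding beta_sep_module_def by (rule LeastI[of _ 9]) (simp add: degree_9_separating[OF rep])
    then show ?thesis using low by (meson not_less)
  qed
  show ?thesis
  proof (rule antisym)
    have "enat (beta_sep_module H27 n \<sigma>) \<le> 9" if "is_rep H27 n \<sigma>" for n and \<sigma> :: "_ \<Rightarrow> 'k mat"
      using up[OF that] by (simp add: numeral_eq_enat)
    then show "beta_sep TYPE('k) H27 \<le> 9"
      unfolding beta_sep_def by (intro SUP_least) auto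
    have "(9 :: enat) \<le> enat (beta_sep_module H27 3 \<rho>)"
      using \<open>9 \<le> beta_sep_module H27 3 \<rho>\<close> by (simp add: numeral_eq_enat)
    also have "\<dots> \<le> beta_sep TYPE('k) H27"
      unfolding beta_sep_def
      by (rule SUP_upper2[of "(3, \<rho>)"]) (simp_all add: rep)
    finally show "9 \<le> beta_sep TYPE('k) H27" .
  qed
qed

end
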